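(* Let $k$ be a positive integer. There is a Borel map $S:(\tilde{\mathcal{W}}^k_0,\delta_1)\to(\mathcal{W}^k_0,d_1)$ such that $S(\tilde W)\in\tilde W$ for every $\tilde W\in\tilde{\mathcal{W}}^k_0$.
   Context: $[k]=\{1,\dots,k\}$; for a finite set $A$, $r(A)$ is the set of nonempty subsets of $A$. $X=[0,1]^{r([k])}$ with product Lebesgue measure $\lambda$. Each $\sigma\in S_k$ induces a coordinate-permuting map $\tilde\sigma:X\to X$. A $k$-uniform hypergraphon is a measurable $W\subseteq X$ with $\tilde\sigma(W)=W$ for all $\sigma$ (null-set differences identified); $\mathcal{W}^k_0$ is the set of them, with $d_1(U,W)=\lambda(U\triangle W)$. For $S'\in r([k])$, $\pi_{S'}:X\to[0,1]^{r(S')}$ is the projection, $\mathcal{A}_{S'}$ the pull-back $\sigma$-algebra, $\mathcal{A}^*_{S'}$ the $\sigma$-algebra generated by $\mathcal{A}_T$ for nonempty $T\subsetneq S'$. A map $\psi:X\to X$ is structure preserving if it is measure preserving, commutes with every $\tilde\sigma$, satisfies $\psi^{-1}(\mathcal{A}_{S'})\subseteq\mathcal{A}_{S'}$ for all $S'$, and for every $S'$ and measurable $A\subseteq[0,1]$ the set $\psi^{-1}(\{x:x(S')\in A\})$ is independent of $\mathcal{A}^*_{S'}$. With $W^\psi=\psi^{-1}(W)$, $\delta_1(U,W)=\inf_{\psi,\varphi}d_1(U^\varphi,W^\psi)$ over structure preserving $\psi,\varphi$. $\tilde{\mathcal{W}}^k_0$ is the quotient of $\mathcal{W}^k_0$ by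 $U\sim W\iff\delta_1(U,W)=0$; $\tilde W$ is the class of $W$, and $\delta_1(\tilde U,\tilde W)=\delta_1(U,W)$ is the induced metric. *)

theory Defs
  imports "HOL-Probability.Probability" "HOL-Combinatorics.Permutations"
begin

definition rsets :: "nat set \<Rightarrow> nat set set" where
  "rsets A = {S. S \<subseteq> A \<and> S \<noteq> {}}"

text \<open>The measure space \<open>[0,1]\<^bsup>r(A)\<^esup>\<close>. Its points are functions extensional on \<open>rsets A\<close>, and its
  measurable sets are the Borel sets.\<close>

definition cube :: "nat set \<Rightarrow> (nat set \<Rightarrow> real) measure" where
  "cube A = Pi\<^sub>M (rsets A) (\<lambda>_. restrict_space lborel {0..1})"

definition Xk :: "nat \<Rightarrow> (nat set \<Rightarrow> real) measure" where
  "Xk k = cube {1..k}"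

definition perm_map :: "nat \<Rightarrow> (nat \<Rightarrow> nat) \<Rightarrow> (nat set \<Rightarrow> real) \<Rightarrow> (nat set \<Rightarrow> real)" where
  "perm_map k \<sigma> x = (\<lambda>S\<in>rsets {1..k}. x (\<sigma> ` S))"

definition hypergraphon :: "nat \<Rightarrow> (nat set \<Rightarrow> real) set \<Rightarrow> bool" where
  "hypergraphon k W \<longleftrightarrow>
     W \<in> sets (Xk k) \<and> (\<forall>\<sigma>. \<sigma> permutes {1..k} \<longrightarrow> perm_map k \<sigma> ` W = W)"

definition coord_alg :: "nat \<Rightarrow> nat set \<Rightarrow> (nat set \<Rightarrow> real) set set" where
  "coord_alg k S = sets (vimage_algebra (space (Xk k)) (\<lambda>x. restrict x (rsets S)) (cube S))"

definition coord_alg_star :: "nat \<Rightarrow> nat set \<Rightarrow> (nat set \<Rightarrow> real) set set" where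
  "coord_alg_star k S =
     sigma_sets (space (Xk k)) (\<Union>T\<in>{T. T \<noteq> {} \<and> T \<subset> S}. coord_alg k T)"

definition pullback ::
    "nat \<Rightarrow> ((nat set \<Rightarrow> real) \<Rightarrow> (nat set \<Rightarrow> real)) \<Rightarrow> (nat set \<Rightarrow> real) set \<Rightarrow> (nat set \<Rightarrow> real) set" where
  "pullback k \<psi> W = \<psi> -` W \<inter> space (Xk k)"

definition structure_preserving ::
    "nat \<Rightarrow> ((nat set \<Rightarrow> real) \<Rightarrow> (nat set \<Rightarrow> real)) \<Rightarrow> bool" where
  "structure_preserving k \<psi> \<longleftrightarrow>
     \<psi> \<in> measurable (Xk k) (Xk k) \<and>
     (\<forall>B\<in>sets (Xk k). emeasure (Xk k) (pullback k \<psi> B) = emeasure (Xk k) B) \<and>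
     (\<forall>\<sigma>. \<sigma> permutes {1..k} \<longrightarrow>
        (\<forall>x\<in>space (Xk k). \<psi> (perm_map k \<sigma> x) = perm_map k \<sigma> (\<psi> x))) \<and>
     (\<forall>S\<in>rsets {1..k}. \<forall>B\<in>coord_alg k S. pullback k \<psi> B \<in> coord_alg k S) \<and>
     (\<forall>S\<in>rsets {1..k}. \<forall>A\<in>sets (restrict_space lborel {0..1}).
        prob_space.indep_set (Xk k)
          {pullback k \<psi> {x \<in> space (Xk k). x S \<in> A}} (coord_alg_star k S))"

definition d1 :: "nat \<Rightarrow> (nat set \<Rightarrow> real) set \<Rightarrow> (nat set \<Rightarrow> real) set \<Rightarrow> real" where
  "d1 k U W = measure (Xk k) (sym_diff U W)"

definition delta1 :: "nat \<Rightarrow> (nat set \<Rightarrow> real) set \<Rightarrow> (nat set \<Rightarrow> real) set \<Rightarrow> real" where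
  "delta1 k U W =
     Inf {d1 k (pullback k \<phi> U) (pullback k \<psi> W) | \<phi> \<psi>.
            structure_preserving k \<phi> \<and> structure_preserving k \<psi>}"

text \<open>The common value of \<open>d\<close> on all pairs of representatives of two classes in \<open>M\<close>. The value
  outside \<open>M\<close> is \<open>0\<close> because the locale \<open>Metric_space\<close> requires a distance to be nonnegative and
  symmetric on the whole type.\<close>

definition class_dist :: "'a set set \<Rightarrow> ('a \<Rightarrow> 'a \<Rightarrow> real) \<Rightarrow> 'a set \<Rightarrow> 'a set \<Rightarrow> real" where
  "class_dist M d P Q =
     (if P \<in> M \<and> Q \<in> M then the_elem ((\<lambda>(U, W). d U W) ` (P \<times> Q)) else 0)"

text \<open>A point of \<open>W0 k\<close> is a class of hypergraphons modulo null sets; a point of \<open>Wt0 k\<close> is a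
  set of such classes.\<close>

definition W0 :: "nat \<Rightarrow> (nat set \<Rightarrow> real) set set set" where
  "W0 k = {W. hypergraphon k W} //
            {(U, W). hypergraphon k U \<and> hypergraphon k W \<and> emeasure (Xk k) (sym_diff U W) = 0}"

definition dist_W0 :: "nat \<Rightarrow> (nat set \<Rightarrow> real) set set \<Rightarrow> (nat set \<Rightarrow> real) set set \<Rightarrow> real" where
  "dist_W0 k = class_dist (W0 k) (d1 k)"

definition delta1_W0 :: "nat \<Rightarrow> (nat set \<Rightarrow> real) set set \<Rightarrow> (nat set \<Rightarrow> real) set set \<Rightarrow> real" where
  "delta1_W0 k = class_dist (W0 k) (delta1 k)"

definition Wt0 :: "nat \<Rightarrow> (nat set \<Rightarrow> real) set set set set" where
  "Wt0 k = W0 k // {(P, Q). P \<in> W0 k \<and> Q \<in> W0 k \<and> delta1_W0 k P Q = 0}"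

definition dist_Wt0 ::
    "nat \<Rightarrow> (nat set \<Rightarrow> real) set set set \<Rightarrow> (nat set \<Rightarrow> real) set set set \<Rightarrow> real" where
  "dist_Wt0 k = class_dist (Wt0 k) (delta1_W0 k)"

definition metric_borel :: "'a set \<Rightarrow> ('a \<Rightarrow> 'a \<Rightarrow> real) \<Rightarrow> 'a measure" where
  "metric_borel M d = sigma M {U. openin (Metric_space.mtopology M d) U}"

end

theory Submission
  imports Defs
begin

text \<open>
  The point is that a structure preserving map \<open>\<psi>\<close> has approximate right inverses: for every \<open>N\<close> there
  is a structure preserving \<open>\<rho>\<close> such that almost surely \<open>\<psi> (\<rho> x)\<close> and \<open>x\<close> lie in the same cell of the
  grid of mesh \<open>1 / N\<close>. It is built level by level. For \<open>S\<close> with \<open>card S = s\<close>, once the coordinates of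
  the proper subsets of \<open>S\<close> are fixed, \<open>\<psi>\<close> acts on the coordinate \<open>S\<close> as a measure preserving map of
  the unit interval, and such a map is inverted up to \<open>1 / N\<close> by the quantile functions of the preimages
  of the cells. Approximating a hypergraphon \<open>W\<close> by unions of grid cells, the pullback of \<open>W\<close> under
  \<open>\<psi> \<circ> \<rho>\<close> is as close to \<open>W\<close> as we like. Hence \<open>\<delta>\<^sub>1 (U, W)\<close> is the infimum of \<open>d\<^sub>1 (U, W\<^sup>\<psi>)\<close> over \<open>\<psi>\<close>
  alone; this yields the triangle inequality for \<open>\<delta>\<^sub>1\<close> and says that the quotient map is open. An open
  quotient of a complete separable metric space has a Borel selector.
\<close>

section \<open>The measure space\<close>

text \<open>The obstacle is that a measure preserving map such as t \<mapsto> 2t mod 1 has no right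
  inverse that preserves measure. At a fixed mesh, however, only cells have to be matched: the
  preimage of a cell has the same mass 1/N as the cell, so a cell can be sent onto its preimage by a
  measure preserving map, and nothing inside a cell has to be recovered. Quantile functions are
  chosen because they are canonical. An arbitrary isomorphism would have to be selected measurably
  in the lower coordinates and compatibly with all permutations; a quantile function is determined
  by the fibre map and inherits both properties. Levels go upwards because the fibre at
  \<open>S\<close> is known only after the coordinates of the proper subsets have been corrected,
  and changes at \<open>S\<close> do not act on the levels below. The infimum becomes one-sided
  because \<open>d1\<close> is unchanged when both arguments are pulled back along
  \<open>\<rho>\<close>: if \<phi> after \<rho> nearly fixes U, the pair (\<phi>, \<psi>) can be
  traded for the identity and \<psi> after \<rho>.\<close>

abbreviation unit_leb :: "real measure" where
  "unit_leb \<equiv> restrict_space lborel {0..1}"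

lemma prob_space_unit_leb: "prob_space unit_leb"
  by (rule prob_spaceI) (simp add: emeasure_restrict_space space_restrict_space)

interpretation unit_leb: prob_space unit_leb
  by (rule prob_space_unit_leb)

interpretation unit_prod: product_sigma_finite "\<lambda>_ :: nat set. unit_leb"
  by standard

lemma space_unit_leb [simp]: "space unit_leb = {0..1}"
  by (simp add: space_restrict_space)

lemma sets_unit_leb: "A \<in> sets unit_leb \<longleftrightarrow> A \<in> sets borel \<and> A \<subseteq> {0..1}"
  by (auto simp: sets_restrict_space_iff)

lemma measurable_unit_leb_borel:
  "f \<in> measurable M unit_leb \<Longrightarrow> f \<in> borel_measurable M"
  by (auto simp: measurable_restrict_space2_iff)

lemma measurable_unit_lebI:
  "f \<in> borel_measurable M \<Longrightarrow> (\<And>x. x \<in> space M \<Longrightarrow> f x \<in> {0..1}) \<Longrightarrow> f \<in> measurable M unit_leb"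
  by (auto intro!: measurable_restrict_space2 simp: measurable_cong_sets[OF refl sets_lborel])

lemma finite_rsets [simp]: "finite A \<Longrightarrow> finite (rsets A)"
  by (simp add: rsets_def)

lemma rsets_in_rsets: "S \<in> rsets A \<Longrightarrow> rsets S \<subseteq> rsets A"
  by (auto simp: rsets_def)

lemma rsets_self [simp]: "S \<in> rsets A \<Longrightarrow> S \<in> rsets S"
  by (auto simp: rsets_def)

lemma prob_space_Xk: "prob_space (Xk k)"
  unfolding Xk_def cube_def by (rule prob_space_PiM) (rule prob_space_unit_leb)

interpretation Xk: prob_space "Xk k" for k
  by (rule prob_space_Xk)

lemma space_Xk: "space (Xk k) = (\<Pi>\<^sub>E S\<in>rsets {1..k}. {0..1})"
  by (simp add: Xk_def cube_def space_PiM)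

lemma Xk_range: "x \<in> space (Xk k) \<Longrightarrow> S \<in> rsets {1..k} \<Longrightarrow> x S \<in> {0..1}"
  unfolding space_Xk by (rule PiE_mem)

lemma Xk_range': "x \<in> space (Xk k) \<Longrightarrow> S \<in> rsets {1..k} \<Longrightarrow> 0 \<le> x S \<and> x S \<le> 1"
  using Xk_range by fastforce

lemma Xk_fun_upd:
  "x \<in> space (Xk k) \<Longrightarrow> S \<in> rsets {1..k} \<Longrightarrow> t \<in> {0..1} \<Longrightarrow> x(S := t) \<in> space (Xk k)"
  using PiE_fun_upd[of t "\<lambda>_. {0..1}" S x "rsets {1..k}"] by (simp add: space_Xk insert_absorb)

lemma measurable_Xk_component:
  "S \<in> rsets {1..k} \<Longrightarrow> (\<lambda>x. x S) \<in> measurable (Xk k) unit_leb"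
  unfolding Xk_def cube_def by (rule measurable_component_singleton)

lemma measurable_into_Xk:
  assumes "\<And>S. S \<in> rsets {1..k} \<Longrightarrow> (\<lambda>x. f x S) \<in> measurable M unit_leb"
    and "\<And>x. x \<in> space M \<Longrightarrow> f x \<in> extensional (rsets {1..k})"
  shows "f \<in> measurable M (Xk k)"
  unfolding Xk_def cube_def
  by (rule measurable_PiM_single')
    (use assms measurable_space[OF assms(1)] in \<open>auto simp: PiE_iff\<close>)

lemma measurable_Xk_upd:
  assumes "S \<in> rsets {1..k}" "f \<in> measurable M (Xk k)" "g \<in> measurable M unit_leb"
  shows "(\<lambda>x. (f x)(S := g x)) \<in> measurable M (Xk k)"
  using assms unfolding Xk_def cube_def
  by (intro measurable_fun_upd[where J="rsets {1..k}"]) auto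

text \<open>The law of the cube is unchanged when the coordinate \<open>S\<close> is replaced by an
  independent uniform variable. In this form of Fubini the outer variable still ranges over the
  whole cube, so a fibre over the remaining coordinates is indexed by any of its points
  \<open>x\<close>, and \<open>x(S := t)\<close> moves along it.\<close>

lemma nn_integral_resample:
  assumes S: "S \<in> rsets {1..k}" and f: "f \<in> borel_measurable (Xk k)"
  shows "(\<integral>\<^sup>+x. f x \<partial>Xk k) = (\<integral>\<^sup>+x. (\<integral>\<^sup>+t. f (x(S := t)) \<partial>unit_leb) \<partial>Xk k)"
proof -
  define J where "J = rsets {1..k} - {S}"
  have J: "finite J" "S \<notin> J" and X: "Xk k = Pi\<^sub>M (insert S J) (\<lambda>_. unit_leb)"
    using S by (auto simp: J_def Xk_def cube_def insert_absorb)
  \<comment> \<open>\<open>g\<close> ignores the coordinate \<open>S\<close>, so its integral over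
    the whole cube equals its integral over the other coordinates.\<close>
  define g where "g x = (\<integral>\<^sup>+t. f (x(S := t)) \<partial>unit_leb)" for x
  have "(\<lambda>p. (fst p)(S := snd p)) \<in> measurable (Xk k \<Otimes>\<^sub>M unit_leb) (Xk k)"
    by (rule measurable_Xk_upd[OF S]) auto
  from measurable_compose[OF this f]
  have g: "g \<in> borel_measurable (Xk k)"
    unfolding g_def by (intro unit_leb.borel_measurable_nn_integral) (simp add: split_beta')
  have "integral\<^sup>N (Xk k) g = (\<integral>\<^sup>+x. (\<integral>\<^sup>+y. g (x(S := y)) \<partial>unit_leb) \<partial>Pi\<^sub>M J (\<lambda>_. unit_leb))"
    using unit_prod.product_nn_integral_insert[OF J, of g] g X by simp
  also have "\<dots> = (\<integral>\<^sup>+x. g x \<partial>Pi\<^sub>M J (\<lambda>_. unit_leb))"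
    using unit_leb.emeasure_space_1 by (simp add: g_def)
  also have "\<dots> = integral\<^sup>N (Xk k) f"
    using unit_prod.product_nn_integral_insert[OF J, of f] f X by (simp add: g_def)
  finally show ?thesis unfolding g_def[abs_def] ..
qed

lemma measurable_section:
  assumes "S \<in> rsets {1..k}" "B \<in> sets (Xk k)" "x \<in> space (Xk k)"
  shows "{t \<in> {0..1}. x(S := t) \<in> B} \<in> sets unit_leb"
proof -
  have "(\<lambda>t. x(S := t)) \<in> measurable unit_leb (Xk k)"
    by (rule measurable_Xk_upd[OF assms(1)]) (use assms(3) in auto)
  from measurable_sets[OF this assms(2)] show ?thesis
    by (simp add: vimage_def Int_def conj_commute)
qed

lemma emeasure_resample:
  assumes S: "S \<in> rsets {1..k}" and B: "B \<in> sets (Xk k)"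
  shows "emeasure (Xk k) B = (\<integral>\<^sup>+x. emeasure unit_leb {t \<in> {0..1}. x(S := t) \<in> B} \<partial>Xk k)"
proof -
  have "emeasure (Xk k) B = (\<integral>\<^sup>+x. (\<integral>\<^sup>+t. indicator B (x(S := t)) \<partial>unit_leb) \<partial>Xk k)"
    using nn_integral_resample[OF S, of "indicator B"] B by simp
  also have "\<dots> = (\<integral>\<^sup>+x. emeasure unit_leb {t \<in> {0..1}. x(S := t) \<in> B} \<partial>Xk k)"
  proof (rule nn_integral_cong)
    fix x assume "x \<in> space (Xk k)"
    note m = measurable_section[OF S B this]
    have "(\<integral>\<^sup>+t. indicator B (x(S := t)) \<partial>unit_leb)
        = (\<integral>\<^sup>+t. indicator {t \<in> {0..1}. x(S := t) \<in> B} t \<partial>unit_leb)"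
      by (rule nn_integral_cong) (auto split: split_indicator)
    then show "(\<integral>\<^sup>+t. indicator B (x(S := t)) \<partial>unit_leb) = emeasure unit_leb {t \<in> {0..1}. x(S := t) \<in> B}"
      using m by simp
  qed
  finally show ?thesis .
qed

lemma AE_resample:
  assumes S: "S \<in> rsets {1..k}" and P: "{x \<in> space (Xk k). P x} \<in> sets (Xk k)"
    and AE: "AE x in Xk k. AE t in unit_leb. P (x(S := t))"
  shows "AE x in Xk k. P x"
proof -
  have N: "{x \<in> space (Xk k). \<not> P x} \<in> sets (Xk k)"
    using sets.compl_sets[OF P] by (rule back_subst[where P="\<lambda>A. A \<in> sets (Xk k)"]) auto
  have "emeasure (Xk k) {x \<in> space (Xk k). \<not> P x}
      = (\<integral>\<^sup>+x. emeasure unit_leb {t \<in> {0..1}. x(S := t) \<in> {x \<in> space (Xk k). \<not> P x}} \<partial>Xk k)"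
    by (rule emeasure_resample[OF S N])
  also have "\<dots> = (\<integral>\<^sup>+x. 0 \<partial>Xk k)"
  proof (rule nn_integral_cong_AE, use AE AE_space in eventually_elim)
    case (elim x)
    have "AE t in unit_leb. t \<notin> {t \<in> {0..1}. x(S := t) \<in> {x \<in> space (Xk k). \<not> P x}}"
      using elim(1) by eventually_elim auto
    then show ?case
      using measurable_section[OF S N elim(2)] by (subst (asm) AE_iff_null_sets[symmetric]) auto
  qed
  finally show ?thesis
    using N by (intro AE_I[where N="{x \<in> space (Xk k). \<not> P x}"]) auto
qed

section \<open>Sets determined by some of the coordinates\<close>

text \<open>A pointwise substitute for the sigma-algebra generated by the coordinates in
  \<open>J\<close>. Both \<open>coord_alg\<close> and \<open>coord_alg_star\<close> turn out to have
  this form, so that later arguments compare points instead of generators.\<close>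

definition determined_by :: "nat \<Rightarrow> nat set set \<Rightarrow> (nat set \<Rightarrow> real) set \<Rightarrow> bool" where
  "determined_by k J B \<longleftrightarrow> B \<in> sets (Xk k) \<and>
     (\<forall>x\<in>space (Xk k). \<forall>y\<in>space (Xk k). (\<forall>T\<in>J. x T = y T) \<longrightarrow> x \<in> B \<longrightarrow> y \<in> B)"

lemma determined_byI:
  assumes "B \<in> sets (Xk k)"
    and "\<And>x y. x \<in> B \<Longrightarrow> y \<in> space (Xk k) \<Longrightarrow> (\<And>T. T \<in> J \<Longrightarrow> x T = y T) \<Longrightarrow> y \<in> B"
  shows "determined_by k J B"
  using assms unfolding determined_by_def by blast

lemma determined_by_sets: "determined_by k J B \<Longrightarrow> B \<in> sets (Xk k)"
  by (simp add: determined_by_def)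

lemma determined_byD:
  assumes "determined_by k J B" "x \<in> B" "y \<in> space (Xk k)" "\<And>T. T \<in> J \<Longrightarrow> x T = y T"
  shows "y \<in> B"
  using assms sets.sets_into_space[OF determined_by_sets[OF assms(1)]] unfolding determined_by_def by blast

text \<open>A section of the restriction map does the work: \<open>?e\<close> fills the coordinates
  outside \<open>J\<close> by 0, and a point and its refilled restriction agree on \<open>J\<close>,
  hence lie in \<open>B\<close> together. The resulting equality of sets is exact, not up to null
  sets.\<close>

lemma determined_byE:
  assumes "J \<subseteq> rsets {1..k}" "determined_by k J B"
  obtains B' where "B' \<in> sets (Pi\<^sub>M J (\<lambda>_. unit_leb))"
    "B = (\<lambda>x. restrict x J) -` B' \<inter> space (Xk k)"
proof -
  let ?e = "\<lambda>z. \<lambda>T\<in>rsets {1..k}. if T \<in> J then z T else (0::real)"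
  have "?e \<in> measurable (Pi\<^sub>M J (\<lambda>_. unit_leb)) (Xk k)"
  proof (rule measurable_into_Xk)
    fix T assume "T \<in> rsets {1..k}"
    then show "(\<lambda>z. ?e z T) \<in> measurable (Pi\<^sub>M J (\<lambda>_. unit_leb)) unit_leb"
      by (cases "T \<in> J") (simp_all add: measurable_component_singleton)
  qed auto
  moreover have "B \<in> sets (Xk k)" using assms by (simp add: determined_by_def)
  ultimately have m: "?e -` B \<inter> space (Pi\<^sub>M J (\<lambda>_. unit_leb)) \<in> sets (Pi\<^sub>M J (\<lambda>_. unit_leb))" (is "?B' \<in> _")
    by (rule measurable_sets)
  have iff: "x \<in> B \<longleftrightarrow> ?e (restrict x J) \<in> B" if x: "x \<in> space (Xk k)" for x
  proof -
    have e: "?e (restrict x J) \<in> space (Xk k)"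
      using Xk_range[OF x] by (auto simp: space_Xk)
    have eq: "x T = ?e (restrict x J) T" if "T \<in> J" for T using that assms(1) by auto
    show ?thesis
      using determined_byD[OF assms(2) _ e eq] determined_byD[OF assms(2) _ x eq[symmetric]] by blast
  qed
  have sp: "restrict x J \<in> space (Pi\<^sub>M J (\<lambda>_. unit_leb))" if x: "x \<in> space (Xk k)" for x
    using Xk_range[OF x] assms(1) by (auto simp: space_PiM)
  have "B \<subseteq> space (Xk k)" using assms by (auto simp: determined_by_def dest: sets.sets_into_space)
  with iff sp have "B = (\<lambda>x. restrict x J) -` ?B' \<inter> space (Xk k)" by auto
  with m show ?thesis by (rule that)
qed

lemma determined_by_coord_alg:
  assumes "S \<in> rsets {1..k}"
  shows "B \<in> coord_alg k S \<longleftrightarrow> determined_by k (rsets S) B"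
proof
  have sub: "rsets S \<subseteq> rsets {1..k}" using assms by (rule rsets_in_rsets)
  have r: "(\<lambda>x. restrict x (rsets S)) \<in> space (Xk k) \<rightarrow> space (cube S)"
    unfolding Xk_def cube_def by (rule measurable_space[OF measurable_restrict_subset[OF sub], THEN funcsetI])
  {
    assume "B \<in> coord_alg k S"
    then obtain A where A: "A \<in> sets (cube S)" "B = (\<lambda>x. restrict x (rsets S)) -` A \<inter> space (Xk k)"
      unfolding coord_alg_def sets_vimage_algebra2[OF r] by auto
    have "(\<lambda>x. restrict x (rsets S)) \<in> measurable (Xk k) (cube S)"
      unfolding Xk_def cube_def by (rule measurable_restrict_subset[OF sub])
    then have "B \<in> sets (Xk k)" using A by (auto dest: measurable_sets)
    moreover have "y \<in> B" if "x \<in> B" "y \<in> space (Xk k)" "\<forall>T\<in>rsets S. x T = y T" for x y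
    proof -
      have "restrict x (rsets S) = restrict y (rsets S)" using that by auto
      with that A show ?thesis by auto
    qed
    ultimately show "determined_by k (rsets S) B" unfolding determined_by_def by blast
  }
  {
    assume "determined_by k (rsets S) B"
    with sub obtain B' where "B' \<in> sets (Pi\<^sub>M (rsets S) (\<lambda>_. unit_leb))"
      "B = (\<lambda>x. restrict x (rsets S)) -` B' \<inter> space (Xk k)" by (rule determined_byE)
    then show "B \<in> coord_alg k S"
      unfolding coord_alg_def sets_vimage_algebra2[OF r] by (auto simp: cube_def)
  }
qed

lemma determined_by_mono: "determined_by k J B \<Longrightarrow> J \<subseteq> J' \<Longrightarrow> determined_by k J' B"
  unfolding determined_by_def by blast

text \<open>For the backward direction, the coordinate of a nonempty proper subset \<open>T\<close>
  of \<open>S\<close> is itself measurable for \<open>coord_alg k T\<close>, so the generated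
  algebra makes the restriction to all coordinates below \<open>S\<close> measurable.\<close>

lemma determined_by_coord_alg_star:
  assumes S: "S \<in> rsets {1..k}"
  shows "B \<in> coord_alg_star k S \<longleftrightarrow> determined_by k (rsets S - {S}) B"
proof
  let ?G = "\<Union>T\<in>{T. T \<noteq> {} \<and> T \<subset> S}. coord_alg k T"
  have T: "T \<in> rsets {1..k}" "rsets T \<subseteq> rsets S - {S}" if "T \<noteq> {}" "T \<subset> S" for T
    using that S by (auto simp: rsets_def)
  {
    assume "B \<in> coord_alg_star k S"
    then have "B \<in> sigma_sets (space (Xk k)) ?G" by (simp add: coord_alg_star_def)
    then show "determined_by k (rsets S - {S}) B"
    proof (induction rule: sigma_sets.induct)
      case (Basic a)
      then obtain T where T': "T \<noteq> {}" "T \<subset> S" "a \<in> coord_alg k T" by auto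
      then show ?case
        using determined_by_mono[OF _ T(2)] determined_by_coord_alg[OF T(1)] by metis
    next
      case (Compl a)
      show ?case
      proof (rule determined_byI)
        fix x y assume xy: "x \<in> space (Xk k) - a" "y \<in> space (Xk k)"
          and eq: "\<And>T. T \<in> rsets S - {S} \<Longrightarrow> x T = y T"
        have "y \<notin> a"
          using determined_byD[OF Compl.IH, of y x] xy eq by (metis DiffE)
        with xy show "y \<in> space (Xk k) - a" by simp
      qed (use determined_by_sets[OF Compl.IH] in auto)
    next
      case (Union a)
      show ?case
      proof (rule determined_byI)
        show "(\<Union>i. a i) \<in> sets (Xk k)" using determined_by_sets[OF Union.IH] by auto
        fix x y assume "x \<in> (\<Union>i. a i)" "y \<in> space (Xk k)"
          and eq: "\<And>T. T \<in> rsets S - {S} \<Longrightarrow> x T = y T"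
        then obtain i where "x \<in> a i" by auto
        from determined_byD[OF Union.IH this \<open>y \<in> space (Xk k)\<close> eq] show "y \<in> (\<Union>i. a i)" by auto
      qed
    qed (simp add: determined_by_def)
  }
  {
    assume det: "determined_by k (rsets S - {S}) B"
    have sub: "rsets S - {S} \<subseteq> rsets {1..k}" using rsets_in_rsets[OF S] by auto
    from det sub obtain B' where B': "B' \<in> sets (Pi\<^sub>M (rsets S - {S}) (\<lambda>_. unit_leb))"
      "B = (\<lambda>x. restrict x (rsets S - {S})) -` B' \<inter> space (Xk k)" by (metis determined_byE)
    have G: "?G \<subseteq> Pow (space (Xk k))"
    proof (intro subsetI PowI)
      fix a x assume "a \<in> ?G" "x \<in> a"
      then obtain T where "T \<noteq> {}" "T \<subset> S" "a \<in> coord_alg k T" by auto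
      with \<open>x \<in> a\<close> show "x \<in> space (Xk k)"
        by (metis T(1) determined_by_coord_alg determined_by_sets sets.sets_into_space subsetD)
    qed
    let ?M = "sigma (space (Xk k)) ?G"
    have "(\<lambda>x. restrict x (rsets S - {S})) \<in> measurable ?M (Pi\<^sub>M (rsets S - {S}) (\<lambda>_. unit_leb))"
    proof (rule measurable_restrict)
      fix T assume T': "T \<in> rsets S - {S}"
      then have T'': "T \<noteq> {}" "T \<subset> S" by (auto simp: rsets_def)
      note Tk = T(1)[OF T'']
      show "(\<lambda>x. x T) \<in> measurable ?M unit_leb"
      proof (rule measurableI)
        fix A assume "A \<in> sets unit_leb"
        then have "(\<lambda>x. x T) -` A \<inter> space (Xk k) \<in> sets (Xk k)"
          using Tk by (intro measurable_sets[OF measurable_Xk_component])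
        then have "determined_by k (rsets T) ((\<lambda>x. x T) -` A \<inter> space (Xk k))"
          using rsets_self[OF Tk] by (intro determined_byI) auto
        then have "(\<lambda>x. x T) -` A \<inter> space (Xk k) \<in> ?G"
          using T'' determined_by_coord_alg[OF Tk] by blast
        then show "(\<lambda>x. x T) -` A \<inter> space ?M \<in> sets ?M"
          using G by (simp add: space_measure_of sets_measure_of)
      qed (use Xk_range Tk in \<open>auto simp: space_measure_of_conv\<close>)
    qed
    from measurable_sets[OF this B'(1)] show "B \<in> coord_alg_star k S"
      using B'(2) G by (simp add: coord_alg_star_def space_measure_of sets_measure_of)
  }
qed

section \<open>Structure preserving maps\<close>

text \<open>The thresholds are rational so that equations known only almost surely can be combined
  by discarding countably many null sets. Monotonicity of the distribution function fills in the
  real thresholds.\<close>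

lemma distr_unit_leb_eqI:
  assumes f: "f \<in> measurable unit_leb unit_leb"
    and eq: "\<And>a. a \<in> \<rat> \<Longrightarrow> 0 \<le> a \<Longrightarrow> a \<le> 1 \<Longrightarrow>
      emeasure unit_leb {t \<in> {0..1}. f t \<le> a} = ennreal a"
  shows "distr unit_leb unit_leb f = unit_leb"
proof -
  let ?F = "\<lambda>x. unit_leb.prob {t \<in> {0..1}. f t \<le> x}"
  let ?G = "\<lambda>x. unit_leb.prob {t \<in> {0..1}. t \<le> x}"
  have f': "f \<in> borel_measurable unit_leb" using f by (rule measurable_unit_leb_borel)
  have id: "(\<lambda>x. x) \<in> borel_measurable unit_leb" by (rule measurable_unit_leb_borel) simp
  have sets: "{t \<in> {0..1}. f t \<le> x} \<in> sets unit_leb" for x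
    using measurable_sets[OF f', of "{..x}"] by (simp add: vimage_def Int_def conj_commute)
  have mono: "?F x \<le> ?F y" if "x \<le> y" for x y
    using that sets by (intro unit_leb.finite_measure_mono) auto
  have rat: "?F a = a" if "a \<in> \<rat>" "0 \<le> a" "a \<le> 1" for a
    using eq[OF that] that by (simp add: measure_def)
  have range: "f t \<in> {0..1}" if "t \<in> {0..1}" for t using measurable_space[OF f] that by auto
  have F: "?F x = min 1 (max 0 x)" for x
  proof -
    consider "x < 0" | "x \<ge> 1" | "0 \<le> x" "x < 1" by linarith
    then show ?thesis
    proof cases
      case 1
      then have "{t \<in> {0..1}. f t \<le> x} = {}" using range by fastforce
      then have "?F x = 0" by (simp only: measure_empty)
      then show ?thesis using 1 by simp
    next
      case 2
      then have "{t \<in> {0..1}. f t \<le> x} = {0..1}" using range by fastforce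
      then show ?thesis using 2 unit_leb.prob_space by simp
    next
      case 3
      have "?F x \<le> x"
      proof (rule field_le_epsilon)
        fix e :: real assume "0 < e"
        then obtain b where "b \<in> \<rat>" "x < b" "b < min 1 (x + e)"
          using Rats_dense_in_real[of x "min 1 (x + e)"] 3 by auto
        then show "?F x \<le> x + e" using rat[of b] mono[of x b] 3 by auto
      qed
      moreover have "x \<le> ?F x"
      proof (cases "x = 0")
        case False
        show ?thesis
        proof (rule field_le_epsilon)
          fix e :: real assume "0 < e"
          then obtain b where "b \<in> \<rat>" "max 0 (x - e) < b" "b < x"
            using Rats_dense_in_real[of "max 0 (x - e)" x] 3 False by auto
          then show "x \<le> ?F x + e" using rat[of b] mono[of b x] 3 by auto
        qed
      qed simp
      ultimately show ?thesis using 3 by simp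
    qed
  qed
  have G: "?G x = min 1 (max 0 x)" for x
  proof -
    have "{t \<in> {0..1}. t \<le> x} = {0..min 1 x}" by auto
    moreover have "{0..min 1 x} \<subseteq> {0..1}" by auto
    ultimately show ?thesis by (simp add: measure_restrict_space)
  qed
  have "cdf (distr unit_leb borel f) = cdf (distr unit_leb borel (\<lambda>x. x))"
  proof
    fix x
    show "cdf (distr unit_leb borel f) x = cdf (distr unit_leb borel (\<lambda>x. x)) x"
      using F[of x] G[of x] f' id by (simp add: cdf_def measure_distr vimage_def Int_def conj_commute)
  qed
  moreover have "real_distribution (distr unit_leb borel f)"
    "real_distribution (distr unit_leb borel (\<lambda>x. x))"
    using f' id by auto
  ultimately have eq: "distr unit_leb borel f = distr unit_leb borel (\<lambda>x. x)"
    by (intro cdf_unique)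
  show ?thesis
  proof (rule measure_eqI)
    fix A assume "A \<in> sets (distr unit_leb unit_leb f)"
    then have A: "A \<in> sets unit_leb" "A \<in> sets borel" "A \<subseteq> {0..1}" by (auto simp: sets_unit_leb)
    have "emeasure (distr unit_leb unit_leb f) A = emeasure (distr unit_leb borel f) A"
      using A f f' by (simp add: emeasure_distr)
    also have "\<dots> = emeasure unit_leb A"
      unfolding eq using A id by (simp add: emeasure_distr Int_absorb2)
    finally show "emeasure (distr unit_leb unit_leb f) A = emeasure unit_leb A" .
  qed simp
qed

lemma emeasure_Xk_component:
  assumes "S \<in> rsets {1..k}" "A \<in> sets unit_leb"
  shows "emeasure (Xk k) {x \<in> space (Xk k). x S \<in> A} = emeasure unit_leb A"
proof -
  have "{x \<in> space (Xk k). x S \<in> A} \<in> sets (Xk k)"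
    using measurable_sets[OF measurable_Xk_component assms(2)] assms(1)
    by (simp add: vimage_def Int_def conj_commute)
  then have "emeasure (Xk k) {x \<in> space (Xk k). x S \<in> A}
    = (\<integral>\<^sup>+x. emeasure unit_leb {t \<in> {0..1}. x(S := t) \<in> {x \<in> space (Xk k). x S \<in> A}} \<partial>Xk k)"
    by (rule emeasure_resample[OF assms(1)])
  also have "\<dots> = (\<integral>\<^sup>+x. emeasure unit_leb A \<partial>Xk k)"
  proof (rule nn_integral_cong)
    fix x assume "x \<in> space (Xk k)"
    then have "{t \<in> {0..1}. x(S := t) \<in> {x \<in> space (Xk k). x S \<in> A}} = A"
      using Xk_fun_upd[OF _ assms(1)] assms(2) by (auto simp: sets_unit_leb)
    then show "emeasure unit_leb {t \<in> {0..1}. x(S := t) \<in> {x \<in> space (Xk k). x S \<in> A}} = emeasure unit_leb A"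
      by simp
  qed
  finally show ?thesis using Xk.emeasure_space_1 by simp
qed

text \<open>The pointwise counterpart of the condition in \<open>structure_preserving\<close> that
  pulling back maps \<open>coord_alg k S\<close> into itself, for all \<open>S\<close> at
  once.\<close>

definition local_map :: "nat \<Rightarrow> ((nat set \<Rightarrow> real) \<Rightarrow> (nat set \<Rightarrow> real)) \<Rightarrow> bool" where
  "local_map k \<psi> \<longleftrightarrow> (\<forall>S\<in>rsets {1..k}. \<forall>x\<in>space (Xk k). \<forall>y\<in>space (Xk k).
     (\<forall>T\<in>rsets S. x T = y T) \<longrightarrow> \<psi> x S = \<psi> y S)"

lemma local_mapD:
  assumes "local_map k \<psi>" "S \<in> rsets {1..k}" "x \<in> space (Xk k)" "y \<in> space (Xk k)"
    "\<And>T. T \<in> rsets S \<Longrightarrow> x T = y T"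
  shows "\<psi> x S = \<psi> y S"
  using assms unfolding local_map_def by blast

lemma pullback_sets:
  "\<psi> \<in> measurable (Xk k) (Xk k) \<Longrightarrow> B \<in> sets (Xk k) \<Longrightarrow> pullback k \<psi> B \<in> sets (Xk k)"
  unfolding pullback_def by (rule measurable_sets)

lemma structure_preserving_measurable:
  "structure_preserving k \<psi> \<Longrightarrow> \<psi> \<in> measurable (Xk k) (Xk k)"
  by (simp add: structure_preserving_def)

lemma structure_preserving_perm_map:
  "structure_preserving k \<psi> \<Longrightarrow> \<sigma> permutes {1..k} \<Longrightarrow> x \<in> space (Xk k) \<Longrightarrow>
    \<psi> (perm_map k \<sigma> x) = perm_map k \<sigma> (\<psi> x)"
  by (simp add: structure_preserving_def)

lemma structure_preserving_distr:
  assumes "structure_preserving k \<psi>"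
  shows "distr (Xk k) (Xk k) \<psi> = Xk k"
  by (rule measure_eqI)
    (use assms in \<open>auto simp: structure_preserving_def emeasure_distr pullback_def\<close>)

text \<open>Points are Borel: pulling back the set where the coordinate \<open>S\<close> has the
  value \<open>\<psi> x S\<close> gives a set determined by \<open>rsets S\<close>. The algebras are
  not completed, so the conclusion holds at all points, without an exceptional set.\<close>

lemma structure_preserving_local:
  assumes "structure_preserving k \<psi>"
  shows "local_map k \<psi>"
  unfolding local_map_def
proof (intro ballI impI)
  fix S x y assume S: "S \<in> rsets {1..k}" and x: "x \<in> space (Xk k)" and y: "y \<in> space (Xk k)"
    and eq: "\<forall>T\<in>rsets S. x T = y T"
  have range: "\<psi> z \<in> space (Xk k)" if "z \<in> space (Xk k)" for z
    using measurable_space[OF structure_preserving_measurable[OF assms] that] .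
  let ?B = "{z \<in> space (Xk k). z S \<in> {\<psi> x S}}"
  have "?B \<in> sets (Xk k)"
    using measurable_sets[OF measurable_Xk_component, OF S, of "{\<psi> x S}"] Xk_range[OF range[OF x] S]
    by (simp add: vimage_def Int_def conj_commute sets_unit_leb)
  then have "determined_by k (rsets S) ?B"
    using rsets_self[OF S] by (intro determined_byI) auto
  then have "?B \<in> coord_alg k S" using determined_by_coord_alg[OF S] by blast
  then have "pullback k \<psi> ?B \<in> coord_alg k S"
    using assms S unfolding structure_preserving_def by blast
  then have "determined_by k (rsets S) (pullback k \<psi> ?B)" using determined_by_coord_alg[OF S] by blast
  moreover have "x \<in> pullback k \<psi> ?B" using x range by (simp add: pullback_def)
  ultimately have "y \<in> pullback k \<psi> ?B" by (rule determined_byD) (use y eq in auto)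
  then show "\<psi> x S = \<psi> y S" by (simp add: pullback_def)
qed

lemma measurable_fibre:
  assumes "S \<in> rsets {1..k}" "\<psi> \<in> measurable (Xk k) (Xk k)" "x \<in> space (Xk k)"
  shows "(\<lambda>t. \<psi> (x(S := t)) S) \<in> measurable unit_leb unit_leb"
  by (rule measurable_compose[OF measurable_compose[OF measurable_Xk_upd[OF assms(1)] assms(2)]
        measurable_Xk_component[OF assms(1)]]) (use assms(3) in auto)

lemma measurable_fibre_pair:
  assumes "S \<in> rsets {1..k}" "\<psi> \<in> measurable (Xk k) (Xk k)"
  shows "(\<lambda>p. \<psi> ((fst p)(S := snd p)) S) \<in> measurable (Xk k \<Otimes>\<^sub>M unit_leb) unit_leb"
  by (rule measurable_compose[OF measurable_compose[OF measurable_Xk_upd[OF assms(1)] assms(2)]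
        measurable_Xk_component[OF assms(1)]]) auto

lemma determined_by_resample_iff:
  assumes "determined_by k (rsets S - {S}) B" "S \<in> rsets {1..k}" "x \<in> space (Xk k)" "t \<in> {0..1}"
  shows "x(S := t) \<in> B \<longleftrightarrow> x \<in> B"
  using determined_byD[OF assms(1), of "x(S := t)" x] determined_byD[OF assms(1), of x "x(S := t)"]
    Xk_fun_upd[OF assms(3,2,4)] assms(3) by auto

text \<open>Independence says that the conditional law of the coordinate \<open>S\<close> of
  \<open>\<psi> x\<close>, given the coordinates below \<open>S\<close>, is its unconditional law,
  and the latter is uniform because \<open>\<psi>\<close> preserves measure. The fibre map at
  \<open>x\<close> realises this conditional law.\<close>

lemma structure_preserving_fibre:
  assumes sp: "structure_preserving k \<psi>" and S: "S \<in> rsets {1..k}"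
  shows "AE x in Xk k. distr unit_leb unit_leb (\<lambda>t. \<psi> (x(S := t)) S) = unit_leb"
proof -
  note m = structure_preserving_measurable[OF sp]
  have "AE x in Xk k. emeasure unit_leb {t \<in> {0..1}. \<psi> (x(S := t)) S \<le> a} = ennreal a"
    if a: "0 \<le> a" "a \<le> 1" for a :: real
  proof -
    \<comment> \<open>\<open>E\<close> is an event in the coordinate \<open>S\<close> of the image,
      and \<open>h x\<close> is its conditional probability given the coordinates below
      \<open>S\<close>.\<close>
    define E where "E = pullback k \<psi> {x \<in> space (Xk k). x S \<in> {0..a}}"
    define h where "h x = emeasure unit_leb {t \<in> {0..1}. \<psi> (x(S := t)) S \<le> a}" for x
    have A: "{0..a} \<in> sets unit_leb" using a by (auto simp: sets_unit_leb)
    have C: "{x \<in> space (Xk k). x S \<in> {0..a}} \<in> sets (Xk k)"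
      using measurable_sets[OF measurable_Xk_component A] S by (simp add: vimage_def Int_def conj_commute)
    then have E: "E \<in> sets (Xk k)" unfolding E_def by (rule pullback_sets[OF m])
    have "emeasure (Xk k) E = emeasure unit_leb {0..a}"
      using sp C emeasure_Xk_component[OF S A] by (simp add: structure_preserving_def E_def)
    also have "\<dots> = ennreal a" using a by (subst emeasure_restrict_space) auto
    finally have PE: "emeasure (Xk k) E = ennreal a" .
    have h_E: "{t \<in> {0..1}. x(S := t) \<in> E} = {t \<in> {0..1}. \<psi> (x(S := t)) S \<le> a}"
      if x: "x \<in> space (Xk k)" for x
      using Xk_fun_upd[OF x S] measurable_space[OF m] Xk_range'[OF _ S]
      by (auto simp: E_def pullback_def)
    have h_meas: "h \<in> borel_measurable (Xk k)"
    proof -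
      have "(\<lambda>p. \<psi> ((fst p)(S := snd p)) S) \<in> borel_measurable (Xk k \<Otimes>\<^sub>M unit_leb)"
        by (rule measurable_unit_leb_borel[OF measurable_fibre_pair[OF S m]])
      then have "{p \<in> space (Xk k \<Otimes>\<^sub>M unit_leb). \<psi> ((fst p)(S := snd p)) S \<le> a} \<in> sets (Xk k \<Otimes>\<^sub>M unit_leb)"
        by measurable
      from unit_leb.measurable_emeasure_Pair[OF this] show ?thesis
        unfolding h_def
        by (rule measurable_cong[THEN iffD1, rotated])
          (auto intro!: arg_cong[where f="emeasure unit_leb"] simp: space_pair_measure)
    qed
    have h_det: "h x = h y"
      if xy: "x \<in> space (Xk k)" "y \<in> space (Xk k)" and eq: "\<And>T. T \<in> rsets S - {S} \<Longrightarrow> x T = y T" for x y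
    proof -
      have "\<psi> (x(S := t)) S = \<psi> (y(S := t)) S" if "t \<in> {0..1}" for t
        using structure_preserving_local[OF sp] S
        by (rule local_mapD) (use that Xk_fun_upd[OF _ S] xy eq in auto)
      then have "{t \<in> {0..1}. \<psi> (x(S := t)) S \<le> a} = {t \<in> {0..1}. \<psi> (y(S := t)) S \<le> a}" by auto
      then show ?thesis by (simp add: h_def)
    qed
    have key: "(\<integral>\<^sup>+x. h x * indicator B x \<partial>Xk k) = (\<integral>\<^sup>+x. ennreal a * indicator B x \<partial>Xk k)"
      if B: "determined_by k (rsets S - {S}) B" for B
    proof -
      note Bs = determined_by_sets[OF B]
      have "Xk.indep_set k {E} (coord_alg_star k S)"
        using sp S A unfolding structure_preserving_def E_def by blast
      moreover have "B \<in> coord_alg_star k S" using B determined_by_coord_alg_star[OF S] by blast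
      ultimately have "Xk.prob k (E \<inter> B) = Xk.prob k E * Xk.prob k B"
        by (intro Xk.indep_setD[of k "{E}" "coord_alg_star k S"]) auto
      then have "emeasure (Xk k) (E \<inter> B) = emeasure (Xk k) E * emeasure (Xk k) B"
        by (simp add: Xk.emeasure_eq_measure ennreal_mult)
      also have "\<dots> = (\<integral>\<^sup>+x. ennreal a * indicator B x \<partial>Xk k)"
        using PE Bs by (simp add: nn_integral_cmult)
      finally have *: "emeasure (Xk k) (E \<inter> B) = (\<integral>\<^sup>+x. ennreal a * indicator B x \<partial>Xk k)" .
      have "emeasure (Xk k) (E \<inter> B) = (\<integral>\<^sup>+x. emeasure unit_leb {t \<in> {0..1}. x(S := t) \<in> E \<inter> B} \<partial>Xk k)"
        using E Bs by (intro emeasure_resample[OF S]) auto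
      also have "\<dots> = (\<integral>\<^sup>+x. h x * indicator B x \<partial>Xk k)"
      proof (rule nn_integral_cong)
        fix x assume x: "x \<in> space (Xk k)"
        have "{t \<in> {0..1}. x(S := t) \<in> E \<inter> B} = (if x \<in> B then {t \<in> {0..1}. \<psi> (x(S := t)) S \<le> a} else {})"
          using determined_by_resample_iff[OF B S x] h_E[OF x] by auto
        then show "emeasure unit_leb {t \<in> {0..1}. x(S := t) \<in> E \<inter> B} = h x * indicator B x"
          by (simp add: h_def)
      qed
      finally show ?thesis using * by simp
    qed
    have det: "determined_by k (rsets S - {S}) {x \<in> space (Xk k). Q (h x)}"
      if "{x \<in> space (Xk k). Q (h x)} \<in> sets (Xk k)" for Q
    proof (rule determined_byI[OF that])
      fix x y assume "x \<in> {x \<in> space (Xk k). Q (h x)}" "y \<in> space (Xk k)"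
        "\<And>T. T \<in> rsets S - {S} \<Longrightarrow> x T = y T"
      then show "y \<in> {x \<in> space (Xk k). Q (h x)}" using h_det[of x y] by auto
    qed
    \<comment> \<open>Since \<open>h\<close> depends only on the coordinates below \<open>S\<close>,
      these are admissible test sets for \<open>key\<close>. On each of them the difference of
      \<open>h\<close> and \<open>a\<close> has one sign, so equal integrals make the set
      null.\<close>
    let ?B = "{x \<in> space (Xk k). ennreal a < h x}" and ?C = "{x \<in> space (Xk k). h x < ennreal a}"
    have B: "?B \<in> sets (Xk k)" and C: "?C \<in> sets (Xk k)" using h_meas by measurable
    have fin: "(\<integral>\<^sup>+x. ennreal a * indicator D x \<partial>Xk k) \<noteq> \<infinity>" if "D \<in> sets (Xk k)" for D
      using that Xk.emeasure_eq_measure by (simp add: nn_integral_cmult ennreal_mult_eq_top_iff)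
    have "AE x in Xk k. h x * indicator ?B x \<le> ennreal a * indicator ?B x"
    proof (rule ccontr)
      assume "\<not> ?thesis"
      moreover have "AE x in Xk k. ennreal a * indicator ?B x \<le> h x * indicator ?B x"
        by (rule AE_I2) (auto split: split_indicator)
      ultimately show False
        using nn_integral_less[OF _ _ fin[OF B], of "\<lambda>x. h x * indicator ?B x"] key[OF det[OF B]] h_meas B
        by auto
    qed
    moreover have "AE x in Xk k. ennreal a * indicator ?C x \<le> h x * indicator ?C x"
    proof (rule ccontr)
      assume "\<not> ?thesis"
      moreover have "AE x in Xk k. h x * indicator ?C x \<le> ennreal a * indicator ?C x"
        by (rule AE_I2) (auto split: split_indicator)
      ultimately show False
        using nn_integral_less[of "\<lambda>x. h x * indicator ?C x" "Xk k" "\<lambda>x. ennreal a * indicator ?C x"]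
          fin[OF C] key[OF det[OF C]] h_meas C by auto
    qed
    ultimately show ?thesis unfolding h_def[symmetric] using AE_space
    proof eventually_elim
      case (elim x)
      then show ?case by (auto split: split_indicator_asm simp: not_le[symmetric])
    qed
  qed
  then have "AE x in Xk k. \<forall>a\<in>\<rat> \<inter> {0..1}.
      emeasure unit_leb {t \<in> {0..1}. \<psi> (x(S := t)) S \<le> a} = ennreal a"
    by (subst AE_ball_countable) (auto intro: countable_Int1 countable_rat)
  then show ?thesis using AE_space
  proof eventually_elim
    case (elim x)
    then show ?case by (intro distr_unit_leb_eqI measurable_fibre[OF S m]) auto
  qed
qed

text \<open>The converse of the pointwise reading: locality and uniform fibres give back the
  inclusion of algebras and the independence. Every structure preserving map constructed below is
  verified through these conditions.\<close>

lemma structure_preservingI: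
  assumes m: "\<psi> \<in> measurable (Xk k) (Xk k)"
    and distr: "distr (Xk k) (Xk k) \<psi> = Xk k"
    and perm: "\<And>\<sigma> x. \<sigma> permutes {1..k} \<Longrightarrow> x \<in> space (Xk k) \<Longrightarrow>
      \<psi> (perm_map k \<sigma> x) = perm_map k \<sigma> (\<psi> x)"
    and loc: "local_map k \<psi>"
    and fib: "\<And>S. S \<in> rsets {1..k} \<Longrightarrow>
      AE x in Xk k. distr unit_leb unit_leb (\<lambda>t. \<psi> (x(S := t)) S) = unit_leb"
  shows "structure_preserving k \<psi>"
  unfolding structure_preserving_def
proof (intro conjI ballI allI impI)
  have pres: "emeasure (Xk k) (pullback k \<psi> B) = emeasure (Xk k) B" if "B \<in> sets (Xk k)" for B
    using emeasure_distr[OF m that] distr by (simp add: pullback_def)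
  then show "emeasure (Xk k) (pullback k \<psi> B) = emeasure (Xk k) B" if "B \<in> sets (Xk k)" for B
    using that by blast
  show "pullback k \<psi> B \<in> coord_alg k S" if S: "S \<in> rsets {1..k}" and "B \<in> coord_alg k S" for S B
  proof -
    have B: "determined_by k (rsets S) B" using that determined_by_coord_alg by blast
    have "determined_by k (rsets S) (pullback k \<psi> B)"
    proof (rule determined_byI)
      show "pullback k \<psi> B \<in> sets (Xk k)"
        using determined_by_sets[OF B] by (rule pullback_sets[OF m])
      fix x y assume x: "x \<in> pullback k \<psi> B" and y: "y \<in> space (Xk k)"
        and eq: "\<And>T. T \<in> rsets S \<Longrightarrow> x T = y T"
      then have x': "x \<in> space (Xk k)" "\<psi> x \<in> B" by (auto simp: pullback_def)
      have "\<psi> x T = \<psi> y T" if "T \<in> rsets S" for T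
      proof (rule local_mapD[OF loc _ x'(1) y])
        show "T \<in> rsets {1..k}" using that rsets_in_rsets[OF S] by auto
        show "x T' = y T'" if "T' \<in> rsets T" for T'
          using that eq rsets_in_rsets[OF \<open>T \<in> rsets S\<close>] by auto
      qed
      then show "y \<in> pullback k \<psi> B"
        using determined_byD[OF B x'(2) measurable_space[OF m y]] y by (auto simp: pullback_def)
    qed
    then show ?thesis using determined_by_coord_alg[OF S] by blast
  qed
  fix S A assume S: "S \<in> rsets {1..k}" and A: "A \<in> sets unit_leb"
  let ?C = "{x \<in> space (Xk k). x S \<in> A}"
  have C: "?C \<in> sets (Xk k)"
    using measurable_sets[OF measurable_Xk_component A] S by (simp add: vimage_def Int_def conj_commute)
  then have E: "pullback k \<psi> ?C \<in> sets (Xk k)"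
    by (rule pullback_sets[OF m])
  have PE: "emeasure (Xk k) (pullback k \<psi> ?C) = emeasure unit_leb A"
    using pres[OF C] emeasure_Xk_component[OF S A] by simp
  show "Xk.indep_set k {pullback k \<psi> ?C} (coord_alg_star k S)"
  proof (rule Xk.indep_setI)
    show "{pullback k \<psi> ?C} \<subseteq> sets (Xk k)" using E by simp
    show "coord_alg_star k S \<subseteq> sets (Xk k)"
      using determined_by_coord_alg_star[OF S] determined_by_sets by blast
    fix a B assume "a \<in> {pullback k \<psi> ?C}" "B \<in> coord_alg_star k S"
    then have a: "a = pullback k \<psi> ?C" and B: "determined_by k (rsets S - {S}) B"
      using determined_by_coord_alg_star[OF S] by auto
    note Bs = determined_by_sets[OF B]
    have "emeasure (Xk k) (a \<inter> B) = (\<integral>\<^sup>+x. emeasure unit_leb {t \<in> {0..1}. x(S := t) \<in> a \<inter> B} \<partial>Xk k)"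
      using E Bs a by (intro emeasure_resample[OF S]) auto
    \<comment> \<open>A set determined by the coordinates below \<open>S\<close> contains all or
      nothing of a fibre, and almost every fibre meets \<open>a\<close> in the mass of
      \<open>A\<close>.\<close>
    also have "\<dots> = (\<integral>\<^sup>+x. emeasure unit_leb A * indicator B x \<partial>Xk k)"
    proof (rule nn_integral_cong_AE, use fib[OF S] AE_space in eventually_elim)
      case (elim x)
      have "emeasure unit_leb {t \<in> {0..1}. \<psi> (x(S := t)) S \<in> A} = emeasure unit_leb A"
        using emeasure_distr[OF measurable_fibre[OF S m elim(2)] A] elim(1)
        by (simp add: vimage_def Int_def conj_commute)
      moreover have "{t \<in> {0..1}. x(S := t) \<in> a \<inter> B} = (if x \<in> B then {t \<in> {0..1}. \<psi> (x(S := t)) S \<in> A} else {})"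
        using determined_by_resample_iff[OF B S elim(2)] Xk_fun_upd[OF elim(2) S] measurable_space[OF m]
        by (auto simp: a pullback_def)
      ultimately show ?case by simp
    qed
    also have "\<dots> = emeasure (Xk k) a * emeasure (Xk k) B"
      using PE Bs a by (simp add: nn_integral_cmult)
    finally show "Xk.prob k (a \<inter> B) = Xk.prob k a * Xk.prob k B"
      by (simp add: measure_def enn2real_mult)
  qed
qed (use m perm in auto)

lemma structure_preserving_id: "structure_preserving k (\<lambda>x. x)"
  by (rule structure_preservingI) (auto simp: local_map_def)

lemma structure_preserving_AE:
  assumes "structure_preserving k \<psi>" "AE x in Xk k. P x"
  shows "AE x in Xk k. P (\<psi> x)"
proof -
  have "AE x in distr (Xk k) (Xk k) \<psi>. P x" using assms structure_preserving_distr by metis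
  then show ?thesis by (rule AE_distrD[OF structure_preserving_measurable[OF assms(1)]])
qed

text \<open>Fibre maps compose: the fibre of the composition at \<open>x\<close> is the fibre of
  \<open>\<phi>\<close> at \<open>x\<close> followed by the fibre of \<open>\<psi>\<close> at
  \<open>\<phi> x\<close>. The exceptional null set of \<open>\<psi>\<close> is pulled back along
  \<open>\<phi>\<close> and stays null.\<close>

lemma structure_preserving_compose:
  assumes \<phi>: "structure_preserving k \<phi>" and \<psi>: "structure_preserving k \<psi>"
  shows "structure_preserving k (\<lambda>x. \<psi> (\<phi> x))"
proof (rule structure_preservingI)
  note m\<phi> = structure_preserving_measurable[OF \<phi>] and m\<psi> = structure_preserving_measurable[OF \<psi>]
  note l\<phi> = structure_preserving_local[OF \<phi>] and l\<psi> = structure_preserving_local[OF \<psi>]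
  show "(\<lambda>x. \<psi> (\<phi> x)) \<in> measurable (Xk k) (Xk k)" using m\<phi> m\<psi> by (rule measurable_compose)
  show "distr (Xk k) (Xk k) (\<lambda>x. \<psi> (\<phi> x)) = Xk k"
    using distr_distr[OF m\<psi> m\<phi>] structure_preserving_distr[OF \<phi>] structure_preserving_distr[OF \<psi>]
    by (simp add: comp_def)
  show "\<psi> (\<phi> (perm_map k \<sigma> x)) = perm_map k \<sigma> (\<psi> (\<phi> x))"
    if "\<sigma> permutes {1..k}" "x \<in> space (Xk k)" for \<sigma> x
    using that structure_preserving_perm_map[OF \<phi>] structure_preserving_perm_map[OF \<psi>]
      measurable_space[OF m\<phi>] by simp
  have sub: "T' \<in> rsets {1..k}" "rsets T' \<subseteq> rsets S" if "S \<in> rsets {1..k}" "T' \<in> rsets S" for S T'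
    using that rsets_in_rsets by blast+
  show "local_map k (\<lambda>x. \<psi> (\<phi> x))"
    unfolding local_map_def
  proof (intro ballI impI)
    fix S x y assume S: "S \<in> rsets {1..k}" and x: "x \<in> space (Xk k)" and y: "y \<in> space (Xk k)"
      and eq: "\<forall>T\<in>rsets S. x T = y T"
    have "\<phi> x T = \<phi> y T" if T: "T \<in> rsets S" for T
      by (rule local_mapD[OF l\<phi> sub(1)[OF S T] x y]) (use sub(2)[OF S T] eq in auto)
    then show "\<psi> (\<phi> x) S = \<psi> (\<phi> y) S"
      using S measurable_space[OF m\<phi>] x y by (intro local_mapD[OF l\<psi>])
  qed
  fix S assume S: "S \<in> rsets {1..k}"
  show "AE x in Xk k. distr unit_leb unit_leb (\<lambda>t. \<psi> (\<phi> (x(S := t))) S) = unit_leb"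
    using structure_preserving_fibre[OF \<phi> S]
      structure_preserving_AE[OF \<phi> structure_preserving_fibre[OF \<psi> S]] AE_space
  proof eventually_elim
    case (elim x)
    let ?f = "\<lambda>t. \<phi> (x(S := t)) S" and ?g = "\<lambda>u. \<psi> ((\<phi> x)(S := u)) S"
    have y: "\<phi> x \<in> space (Xk k)" using measurable_space[OF m\<phi> elim(3)] .
    have f: "?f \<in> measurable unit_leb unit_leb" and g: "?g \<in> measurable unit_leb unit_leb"
      using measurable_fibre[OF S m\<phi> elim(3)] measurable_fibre[OF S m\<psi> y] .
    \<comment> \<open>Among the subsets of \<open>S\<close>, moving \<open>x\<close> along its fibre
      changes only the coordinate \<open>S\<close> of \<open>\<phi> x\<close>, because
      \<open>\<phi>\<close> is local.\<close>
    have eq: "\<psi> (\<phi> (x(S := t))) S = ?g (?f t)" if t: "t \<in> {0..1}" for t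
    proof (rule local_mapD[OF l\<psi> S])
      have xt: "x(S := t) \<in> space (Xk k)" using Xk_fun_upd[OF elim(3) S t] .
      then show "\<phi> (x(S := t)) \<in> space (Xk k)" using measurable_space[OF m\<phi>] by blast
      then have "?f t \<in> {0..1}" by (rule Xk_range[OF _ S])
      then show "(\<phi> x)(S := ?f t) \<in> space (Xk k)" by (rule Xk_fun_upd[OF y S])
      fix T assume T: "T \<in> rsets S"
      show "\<phi> (x(S := t)) T = ((\<phi> x)(S := ?f t)) T"
      proof (cases "T = S")
        case False
        then have "S \<notin> rsets T" using T by (auto simp: rsets_def)
        then have "\<phi> (x(S := t)) T = \<phi> x T"
          by (intro local_mapD[OF l\<phi> sub(1)[OF S T] xt elim(3)]) auto
        then show ?thesis using False by simp
      qed simp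
    qed
    have "distr unit_leb unit_leb (\<lambda>t. \<psi> (\<phi> (x(S := t))) S) = distr unit_leb unit_leb (?g \<circ> ?f)"
      by (rule distr_cong) (auto simp: eq)
    also have "\<dots> = unit_leb"
      using distr_distr[OF g f] elim(1,2) by simp
    finally show ?case .
  qed
qed

section \<open>Quantile maps\<close>

lemma (in prob_space) prob_partition:
  assumes J: "finite J" and C: "\<And>j. j \<in> J \<Longrightarrow> C j \<in> events" and disj: "disjoint_family_on C J"
    and sum: "(\<Sum>j\<in>J. prob (C j)) = 1" and A: "A \<in> events"
  shows "prob A = (\<Sum>j\<in>J. prob (A \<inter> C j))"
proof -
  have U: "(\<Union>j\<in>J. C j) \<in> events" using J C by auto
  have "prob (\<Union>j\<in>J. C j) = 1"
    using finite_measure_finite_Union[OF J _ disj] C sum by auto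
  then have "AE x in M. x \<in> (\<Union>j\<in>J. C j)" using U prob_eq_1 by blast
  then have "prob A = prob (\<Union>j\<in>J. A \<inter> C j)"
    using A C J by (intro finite_measure_eq_AE) auto
  also have "\<dots> = (\<Sum>j\<in>J. prob (A \<inter> C j))"
    using C A disj by (intro finite_measure_finite_Union[OF J]) (auto simp: disjoint_family_on_def)
  finally show ?thesis .
qed

text \<open>The distribution function of Lebesgue measure restricted to the preimage under
  \<open>g\<close> of the half-open cell from \<open>j / N\<close> to \<open>(j + 1) / N\<close>.
  Floors serve as names of cells, and the point 1 gets the extra name N.\<close>

definition cell_mass :: "nat \<Rightarrow> (real \<Rightarrow> real) \<Rightarrow> int \<Rightarrow> real \<Rightarrow> real" where
  "cell_mass N g j t = measure unit_leb {s \<in> {0..1}. s \<le> t \<and> \<lfloor>real N * g s\<rfloor> = j}"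

text \<open>The guard in the quantile map. Fibres of a structure preserving map are measure
  preserving only almost surely, and this finite list of equations is a measurable condition on the
  fibre that is strong enough for the quantiles.\<close>

definition equidistributed :: "nat \<Rightarrow> (real \<Rightarrow> real) \<Rightarrow> bool" where
  "equidistributed N g \<longleftrightarrow> (\<forall>j\<in>{0..<int N}. cell_mass N g j 1 = 1 / real N)"

text \<open>On the cell of \<open>u\<close> in the partition of the unit interval into \<open>N\<close> intervals this is the quantile
  function of Lebesgue measure restricted to the preimage of the cell under \<open>g\<close>. Hence it preserves
  Lebesgue measure and is a right inverse of \<open>g\<close> up to an error of \<open>1 / N\<close>.\<close>

definition cell_quantile :: "nat \<Rightarrow> (real \<Rightarrow> real) \<Rightarrow> real \<Rightarrow> real" where
  "cell_quantile N g u =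
     (if equidistributed N g
      then Inf {t \<in> {0..1}. u - real_of_int \<lfloor>real N * u\<rfloor> / real N \<le> cell_mass N g \<lfloor>real N * u\<rfloor> t}
      else u)"

lemma floor_cell_iff:
  assumes "N > 0"
  shows "\<lfloor>real N * u\<rfloor> = j \<longleftrightarrow> u \<in> {of_int j / real N..<of_int (j + 1) / real N}"
  using assms by (auto simp: floor_eq_iff field_simps)

lemma floor_cell_range:
  assumes "N > 0" "0 \<le> u" "u < 1"
  shows "\<lfloor>real N * u\<rfloor> \<in> {0..<int N}"
  using assms by (auto simp: floor_less_iff)

locale cell_partition =
  fixes N :: nat and g :: "real \<Rightarrow> real"
  assumes N: "N > 0" and g: "g \<in> measurable unit_leb unit_leb"
begin

lemma g_borel [measurable]: "g \<in> borel_measurable unit_leb"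
  using g by (rule measurable_unit_leb_borel)

lemma cell_sets: "{s \<in> {0..1}. \<lfloor>real N * g s\<rfloor> = j} \<in> sets unit_leb"
proof -
  have "{s \<in> space unit_leb. \<lfloor>real N * g s\<rfloor> = j} \<in> sets unit_leb" by measurable
  then show ?thesis by simp
qed

lemma cell_sets_le: "{s \<in> {0..1}. s \<le> t \<and> \<lfloor>real N * g s\<rfloor> = j} \<in> sets unit_leb"
proof -
  have "{s \<in> {0..1}. s \<le> t} \<in> sets unit_leb"
    by (auto simp: sets_unit_leb)
  then have "{s \<in> {0..1}. s \<le> t} \<inter> {s \<in> {0..1}. \<lfloor>real N * g s\<rfloor> = j} \<in> sets unit_leb"
    using cell_sets by (rule sets.Int)
  then show ?thesis by (rule back_subst[where P="\<lambda>A. A \<in> sets unit_leb"]) auto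
qed

lemma cell_mass_mono: "t \<le> t' \<Longrightarrow> cell_mass N g j t \<le> cell_mass N g j t'"
  unfolding cell_mass_def by (intro unit_leb.finite_measure_mono cell_sets_le) auto

text \<open>The continuity behind \<open>cell_quantile_le_iff\<close>: it makes the infimum in the
  quantile attained.\<close>

lemma cell_mass_lipschitz:
  assumes "0 \<le> t" "t \<le> t'" "t' \<le> 1"
  shows "cell_mass N g j t' \<le> cell_mass N g j t + (t' - t)"
proof -
  have T: "{t<..t'} \<in> sets unit_leb" using assms by (auto simp: sets_unit_leb)
  have "cell_mass N g j t' \<le> unit_leb.prob ({s \<in> {0..1}. s \<le> t \<and> \<lfloor>real N * g s\<rfloor> = j} \<union> {t<..t'})"
    unfolding cell_mass_def using T cell_sets_le by (intro unit_leb.finite_measure_mono) auto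
  also have "\<dots> \<le> cell_mass N g j t + unit_leb.prob {t<..t'}"
    unfolding cell_mass_def using T cell_sets_le by (intro measure_Un_le) auto
  also have "unit_leb.prob {t<..t'} = t' - t"
    using assms by (subst measure_restrict_space) auto
  finally show ?thesis .
qed

lemma equidistributed_if_distr:
  assumes "distr unit_leb unit_leb g = unit_leb"
  shows "equidistributed N g"
  unfolding equidistributed_def
proof
  fix j assume j: "j \<in> {0..<int N}"
  let ?C = "{real_of_int j / real N..<of_int (j + 1) / real N}"
  have "real_of_int (j + 1) \<le> real_of_int (int N)" using j by (intro of_int_le_iff[THEN iffD2]) auto
  then have "0 \<le> real_of_int j / real N" "of_int (j + 1) / real N \<le> 1" using j N by auto
  then have sub: "?C \<subseteq> {0..1}" by auto
  have "cell_mass N g j 1 = unit_leb.prob (g -` ?C \<inter> space unit_leb)"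
    unfolding cell_mass_def by (rule arg_cong[where f="unit_leb.prob"]) (auto simp: floor_cell_iff[OF N])
  also have "\<dots> = measure (distr unit_leb unit_leb g) ?C"
    using sub g by (subst measure_distr) (auto simp: sets_unit_leb)
  also have "\<dots> = 1 / real N"
    unfolding assms using sub N by (subst measure_restrict_space) (auto simp: field_simps)
  finally show "cell_mass N g j 1 = 1 / real N" .
qed

context
  assumes eq: "equidistributed N g"
begin

text \<open>The adjunction between a distribution function and its quantile function. It describes
  sublevel sets of the quantile by \<open>cell_mass\<close>, which yields both the joint
  measurability and the transport of measure.\<close>

lemma cell_quantile_le_iff:
  assumes u: "u \<in> {0..1}" and t: "t \<in> {0..1}"
  shows "cell_quantile N g u \<le> t \<longleftrightarrow>
    u - of_int \<lfloor>real N * u\<rfloor> / real N \<le> cell_mass N g \<lfloor>real N * u\<rfloor> t"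
    and "cell_quantile N g u \<in> {0..1}"
proof -
  define j where "j = \<lfloor>real N * u\<rfloor>"
  define c where "c = u - of_int j / real N"
  define K where "K = {t \<in> {0..1}. c \<le> cell_mass N g j t}"
  have q: "cell_quantile N g u = Inf K"
    using eq by (simp add: cell_quantile_def K_def c_def j_def)
  have "c \<le> cell_mass N g j 1"
  proof (cases "u < 1")
    case True
    then have "j \<in> {0..<int N}" unfolding j_def using floor_cell_range[OF N] u by auto
    then have "cell_mass N g j 1 = 1 / real N" using eq by (simp add: equidistributed_def)
    moreover have "real N * u \<le> of_int j + 1" unfolding j_def by linarith
    ultimately show ?thesis using N by (simp add: c_def field_simps)
  next
    case False
    \<comment> \<open>At the right end point the cell index is N, outside the range of
      \<open>equidistributed\<close>, but the offset \<open>c\<close> is 0 there.\<close>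
    then have "u = 1" using u by auto
    then show ?thesis using N by (simp add: c_def j_def cell_mass_def)
  qed
  then have "1 \<in> K" by (simp add: K_def)
  have bdd: "bdd_below K" by (rule bdd_belowI[of _ 0]) (auto simp: K_def)
  have "Inf K \<le> 1" using cInf_lower[OF \<open>1 \<in> K\<close> bdd] .
  moreover have "0 \<le> Inf K" using \<open>1 \<in> K\<close> by (intro cInf_greatest) (auto simp: K_def)
  ultimately show r: "cell_quantile N g u \<in> {0..1}" by (simp add: q)
  \<comment> \<open>The infimum belongs to \<open>K\<close>: approach it from above and use the
    Lipschitz bound.\<close>
  have "c \<le> cell_mass N g j (Inf K)"
  proof (rule field_le_epsilon)
    fix e :: real assume "0 < e"
    then obtain s where s: "s \<in> K" "s < Inf K + e"
      using cInf_less_iff[of K "Inf K + e"] \<open>1 \<in> K\<close> bdd by auto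
    have "c \<le> cell_mass N g j s" using s by (simp add: K_def)
    also have "\<dots> \<le> cell_mass N g j (Inf K) + (s - Inf K)"
      using s r q cInf_lower[OF s(1) bdd] by (intro cell_mass_lipschitz) (auto simp: K_def)
    finally show "c \<le> cell_mass N g j (Inf K) + e" using s by simp
  qed
  then have "Inf K \<le> t \<longleftrightarrow> c \<le> cell_mass N g j t"
    using cell_mass_mono[of "Inf K" t j] cInf_lower[OF _ bdd, of t] t by (auto simp: K_def)
  then show "cell_quantile N g u \<le> t \<longleftrightarrow>
    u - of_int \<lfloor>real N * u\<rfloor> / real N \<le> cell_mass N g \<lfloor>real N * u\<rfloor> t"
    by (simp add: q c_def j_def)
qed

end

lemma cell_quantile_range: "u \<in> {0..1} \<Longrightarrow> cell_quantile N g u \<in> {0..1}"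
  using cell_quantile_le_iff(2)[of u 0] by (cases "equidistributed N g") (auto simp: cell_quantile_def)

end

text \<open>The fibre map itself varies with \<open>y\<close>, so measurability is needed jointly in
  the fibre and the point. The adjunction replaces the infimum by a comparison with
  \<open>cell_mass\<close>, which is measurable in \<open>y\<close> by Fubini.\<close>

lemma measurable_cell_quantile:
  assumes N: "N > 0" and G: "G \<in> measurable (M \<Otimes>\<^sub>M unit_leb) unit_leb" and u: "u \<in> measurable M unit_leb"
  shows "(\<lambda>y. cell_quantile N (\<lambda>t. G (y, t)) (u y)) \<in> measurable M unit_leb"
proof (rule measurable_unit_lebI)
  have loc: "cell_partition N (\<lambda>t. G (y, t))" if "y \<in> space M" for y
    using N measurable_compose[OF measurable_Pair1'[OF that] G] by unfold_locales auto
  show range: "cell_quantile N (\<lambda>t. G (y, t)) (u y) \<in> {0..1}" if "y \<in> space M" for y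
    using cell_partition.cell_quantile_range[OF loc[OF that]] measurable_space[OF u that] by auto
  have Gb: "G \<in> borel_measurable (M \<Otimes>\<^sub>M unit_leb)" and ub [measurable]: "u \<in> borel_measurable M"
    using G u by (auto dest: measurable_unit_leb_borel)
  have sb: "snd \<in> borel_measurable (M \<Otimes>\<^sub>M unit_leb)"
    by (rule measurable_unit_leb_borel) (rule measurable_snd)
  have F: "(\<lambda>y. cell_mass N (\<lambda>t. G (y, t)) j a) \<in> borel_measurable M" for j a
  proof -
    have "{p \<in> space (M \<Otimes>\<^sub>M unit_leb). snd p \<le> a \<and> \<lfloor>real N * G p\<rfloor> = j} \<in> sets (M \<Otimes>\<^sub>M unit_leb)"
      using Gb sb by measurable
    note unit_leb.measurable_emeasure_Pair[OF this]
    then have "(\<lambda>y. enn2real (emeasure unit_leb (Pair y -` {p \<in> space (M \<Otimes>\<^sub>M unit_leb). snd p \<le> a \<and> \<lfloor>real N * G p\<rfloor> = j})))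
      \<in> borel_measurable M" by measurable
    then show ?thesis
      unfolding cell_mass_def measure_def
      by (rule measurable_cong[THEN iffD1, rotated])
        (auto intro!: arg_cong[where f="\<lambda>A. enn2real (emeasure unit_leb A)"] simp: space_pair_measure)
  qed
  \<comment> \<open>The cell index depends on \<open>y\<close> too, but takes only countably many
    values.\<close>
  then have [measurable]: "(\<lambda>y. cell_mass N (\<lambda>t. G (y, t)) \<lfloor>real N * u y\<rfloor> a) \<in> borel_measurable M" for a
    by (rule measurable_compose_countable) measurable
  have [measurable]: "Measurable.pred M (\<lambda>y. equidistributed N (\<lambda>t. G (y, t)))"
    unfolding equidistributed_def using F by measurable
  show "(\<lambda>y. cell_quantile N (\<lambda>t. G (y, t)) (u y)) \<in> borel_measurable M"
  proof (rule borel_measurableI_le)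
    fix a :: real
    let ?S = "{y \<in> space M. if equidistributed N (\<lambda>t. G (y, t))
      then u y - of_int \<lfloor>real N * u y\<rfloor> / real N \<le> cell_mass N (\<lambda>t. G (y, t)) \<lfloor>real N * u y\<rfloor> a else u y \<le> a}"
    have m: "?S \<in> sets M" by measurable
    \<comment> \<open>The adjunction is stated for thresholds in the unit interval; outside it the
      sublevel set is empty or everything.\<close>
    consider "a < 0" | "a \<ge> 1" | "0 \<le> a" "a \<le> 1" by linarith
    then show "{y \<in> space M. cell_quantile N (\<lambda>t. G (y, t)) (u y) \<le> a} \<in> sets M"
    proof cases
      case 1
      then have "{y \<in> space M. cell_quantile N (\<lambda>t. G (y, t)) (u y) \<le> a} = {}" using range by fastforce
      then show ?thesis by (simp only: sets.empty_sets)
    next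
      case 2
      then have "{y \<in> space M. cell_quantile N (\<lambda>t. G (y, t)) (u y) \<le> a} = space M" using range by fastforce
      then show ?thesis by (simp only: sets.top)
    next
      case 3
      have "cell_quantile N (\<lambda>t. G (y, t)) (u y) \<le> a \<longleftrightarrow> y \<in> ?S" if y: "y \<in> space M" for y
        using cell_partition.cell_quantile_le_iff(1)[OF loc[OF y], of "u y" a] 3 measurable_space[OF u y] y
        by (auto simp: cell_quantile_def)
      then have "{y \<in> space M. cell_quantile N (\<lambda>t. G (y, t)) (u y) \<le> a} = ?S" by auto
      with m show ?thesis by simp
    qed
  qed
qed

section \<open>Transport of cells by the quantile map\<close>

context cell_partition
begin

lemma cell_quantile_measurable: "cell_quantile N g \<in> measurable unit_leb unit_leb"
  using measurable_cell_quantile[OF N measurable_compose[OF measurable_snd g], of "\<lambda>u. u" unit_leb] by simp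

lemma unit_cell_sets: "{u \<in> {0..1}. \<lfloor>real N * u\<rfloor> = j} \<in> sets unit_leb"
proof -
  have "{u \<in> {0..1}. \<lfloor>real N * u\<rfloor> = j} = {0..1} \<inter> {of_int j / real N..<of_int (j + 1) / real N}"
    by (auto simp: floor_cell_iff[OF N])
  then show ?thesis by (simp add: sets_unit_leb)
qed

context
  assumes eq: "equidistributed N g"
begin

text \<open>By the adjunction, the points of cell \<open>j\<close> that are sent below
  \<open>t\<close> form an initial piece of the cell, of length \<open>cell_mass N g j t\<close>.
  Equidistribution ensures that the cell is long enough to hold it.\<close>

lemma cell_quantile_cell_le:
  assumes j: "j \<in> {0..<int N}" and t: "t \<in> {0..1}"
  shows "unit_leb.prob {u \<in> {0..1}. cell_quantile N g u \<le> t \<and> \<lfloor>real N * u\<rfloor> = j} = cell_mass N g j t"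
proof -
  let ?a = "real_of_int j / real N" and ?F = "cell_mass N g j t"
  have F: "0 \<le> ?F" "?F \<le> 1 / real N"
    using eq j cell_mass_mono[of t 1 j] t by (auto simp: equidistributed_def cell_mass_def)
  have "real_of_int (j + 1) \<le> real_of_int (int N)" using j by (intro of_int_le_iff[THEN iffD2]) auto
  then have b: "0 \<le> ?a" "?a + 1 / real N \<le> 1" using N j by (auto simp: field_simps)
  have "{u \<in> {0..1}. cell_quantile N g u \<le> t \<and> \<lfloor>real N * u\<rfloor> = j}
      = {u \<in> {0..1}. u - ?a \<le> ?F \<and> \<lfloor>real N * u\<rfloor> = j}"
    using cell_quantile_le_iff(1)[OF eq] t by auto
  \<comment> \<open>If the piece is the whole cell, the half-open cell lacks the right end point,
    which costs a null set.\<close>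
  also have "\<dots> = {?a..?a + ?F} \<inter> {..<?a + 1 / real N}"
    using b F N by (auto simp: floor_cell_iff[OF N] add_divide_distrib)
  finally have "unit_leb.prob {u \<in> {0..1}. cell_quantile N g u \<le> t \<and> \<lfloor>real N * u\<rfloor> = j}
    = measure lborel ({?a..?a + ?F} \<inter> {..<?a + 1 / real N})"
    using b F by (subst measure_restrict_space) (auto simp: subset_iff)
  also have "\<dots> = measure lborel {?a..?a + ?F}"
  proof (rule measure_eq_AE)
    show "AE u in lborel. u \<in> {?a..?a + ?F} \<inter> {..<?a + 1 / real N} \<longleftrightarrow> u \<in> {?a..?a + ?F}"
      using AE_lborel_singleton[of "?a + ?F"] by eventually_elim (use F in auto)
  qed auto
  finally show ?thesis using F by simp
qed

text \<open>Both sides are finite measures in \<open>A\<close> that agree on half-lines by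
  \<open>cell_quantile_cell_le\<close>, hence on all Borel sets. Their total mass is 1/N, so
  uniqueness is applied to finite Borel measures.\<close>

lemma cell_quantile_cell:
  assumes j: "j \<in> {0..<int N}" and A: "A \<in> sets unit_leb"
  shows "unit_leb.prob {u \<in> {0..1}. cell_quantile N g u \<in> A \<and> \<lfloor>real N * u\<rfloor> = j}
    = unit_leb.prob {s \<in> {0..1}. s \<in> A \<and> \<lfloor>real N * g s\<rfloor> = j}"
proof -
  let ?q = "cell_quantile N g"
  let ?C = "{u \<in> {0..1}. \<lfloor>real N * u\<rfloor> = j}" and ?D = "{s \<in> {0..1}. \<lfloor>real N * g s\<rfloor> = j}"
  have id: "(\<lambda>u. u) \<in> borel_measurable unit_leb" by (rule measurable_unit_leb_borel) simp
  have q: "?q \<in> borel_measurable unit_leb" by (rule measurable_unit_leb_borel[OF cell_quantile_measurable])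
  note C = unit_cell_sets[of j] and D = cell_sets[of j]
  let ?M = "distr (restrict_space unit_leb ?C) borel ?q"
  let ?L = "distr (restrict_space unit_leb ?D) borel (\<lambda>s. s)"
  have M: "measure ?M B = unit_leb.prob {u \<in> {0..1}. ?q u \<in> B \<and> \<lfloor>real N * u\<rfloor> = j}" if B: "B \<in> sets borel" for B
  proof -
    have "measure ?M B = measure (restrict_space unit_leb ?C) (?q -` B \<inter> space (restrict_space unit_leb ?C))"
      using measurable_restrict_space1[OF q] B by (rule measure_distr)
    also have "\<dots> = unit_leb.prob (?q -` B \<inter> space (restrict_space unit_leb ?C))"
      using sets.Int[OF C sets.top] by (intro measure_restrict_space) (auto simp: space_restrict_space)
    also have "?q -` B \<inter> space (restrict_space unit_leb ?C) = {u \<in> {0..1}. ?q u \<in> B \<and> \<lfloor>real N * u\<rfloor> = j}"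
      by (auto simp: space_restrict_space)
    finally show ?thesis .
  qed
  have L: "measure ?L B = unit_leb.prob {s \<in> {0..1}. s \<in> B \<and> \<lfloor>real N * g s\<rfloor> = j}" if B: "B \<in> sets borel" for B
  proof -
    have "measure ?L B = measure (restrict_space unit_leb ?D) ((\<lambda>s. s) -` B \<inter> space (restrict_space unit_leb ?D))"
      using measurable_restrict_space1[OF id] B by (rule measure_distr)
    also have "\<dots> = unit_leb.prob ((\<lambda>s. s) -` B \<inter> space (restrict_space unit_leb ?D))"
      using sets.Int[OF D sets.top] by (intro measure_restrict_space) (auto simp: space_restrict_space)
    also have "(\<lambda>s. s) -` B \<inter> space (restrict_space unit_leb ?D) = {s \<in> {0..1}. s \<in> B \<and> \<lfloor>real N * g s\<rfloor> = j}"
      by (auto simp: space_restrict_space)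
    finally show ?thesis .
  qed
  have "?M = ?L"
  proof (rule cdf_unique')
    show "finite_borel_measure ?M"
      unfolding finite_borel_measure_def finite_borel_measure_axioms_def
      using finite_measure.finite_measure_distr[OF finite_measure_restrict_space[OF unit_leb.finite_measure_axioms C]
          measurable_restrict_space1[OF q]] by simp
    show "finite_borel_measure ?L"
      unfolding finite_borel_measure_def finite_borel_measure_axioms_def
      using finite_measure.finite_measure_distr[OF finite_measure_restrict_space[OF unit_leb.finite_measure_axioms D]
          measurable_restrict_space1[OF id]] by simp
    show "cdf ?M = cdf ?L"
    proof
      fix x :: real
      have qr: "?q u \<in> {0..1}" if "u \<in> {0..1}" for u using that by (rule cell_quantile_range)
      consider "x < 0" | "x \<ge> 1" | "0 \<le> x" "x \<le> 1" by linarith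
      then show "cdf ?M x = cdf ?L x"
      proof cases
        case 1
        then have "{u \<in> {0..1}. ?q u \<in> {..x} \<and> \<lfloor>real N * u\<rfloor> = j} = {}"
          "{s \<in> {0..1}. s \<in> {..x} \<and> \<lfloor>real N * g s\<rfloor> = j} = {}" using qr by fastforce+
        then show ?thesis by (simp only: cdf_def M[OF atMost_borel] L[OF atMost_borel])
      next
        case 2
        then have "{u \<in> {0..1}. ?q u \<in> {..x} \<and> \<lfloor>real N * u\<rfloor> = j} = {u \<in> {0..1}. ?q u \<le> 1 \<and> \<lfloor>real N * u\<rfloor> = j}"
          "{s \<in> {0..1}. s \<in> {..x} \<and> \<lfloor>real N * g s\<rfloor> = j} = {s \<in> {0..1}. s \<le> 1 \<and> \<lfloor>real N * g s\<rfloor> = j}"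
          using qr by fastforce+
        then show ?thesis
          using cell_quantile_cell_le[OF j, of 1]
          by (simp only: cdf_def M[OF atMost_borel] L[OF atMost_borel]) (simp add: cell_mass_def)
      next
        case 3
        then show ?thesis using cell_quantile_cell_le[OF j, of x]
          by (simp only: cdf_def M[OF atMost_borel] L[OF atMost_borel]) (simp add: cell_mass_def)
      qed
    qed
  qed
  then show ?thesis using M[of A] L[of A] A by (simp add: sets_unit_leb)
qed

lemma disjoint_cells: "disjoint_family_on (\<lambda>j. {u \<in> {0..1}. \<lfloor>real N * f u\<rfloor> = j}) J"
  by (auto simp: disjoint_family_on_def)

lemma sum_cell_mass: "(\<Sum>j\<in>{0..<int N}. cell_mass N g j 1) = 1"
  using eq N by (simp add: equidistributed_def)

text \<open>Apply \<open>cell_quantile_cell\<close> to the complement of the preimage of cell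
  \<open>j\<close>: it has no mass inside that preimage, so almost no point of cell \<open>j\<close>
  is sent into it.\<close>

lemma AE_cell_quantile: "AE u in unit_leb. \<lfloor>real N * g (cell_quantile N g u)\<rfloor> = \<lfloor>real N * u\<rfloor>"
proof -
  note qm = cell_quantile_measurable
  have "AE u in unit_leb. \<forall>j\<in>{0..<int N}. \<not> (\<lfloor>real N * g (cell_quantile N g u)\<rfloor> \<noteq> j \<and> \<lfloor>real N * u\<rfloor> = j)"
  proof (rule AE_finite_allI)
    fix j assume j: "j \<in> {0..<int N}"
    let ?A = "{s \<in> {0..1}. \<lfloor>real N * g s\<rfloor> \<noteq> j}"
    have "?A = space unit_leb - {s \<in> {0..1}. \<lfloor>real N * g s\<rfloor> = j}" by auto
    also have "\<dots> \<in> sets unit_leb" by (rule sets.compl_sets[OF cell_sets])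
    finally have A: "?A \<in> sets unit_leb" .
    have "{s \<in> {0..1}. s \<in> ?A \<and> \<lfloor>real N * g s\<rfloor> = j} = {}" by auto
    then have "unit_leb.prob {u \<in> {0..1}. cell_quantile N g u \<in> ?A \<and> \<lfloor>real N * u\<rfloor> = j} = 0"
      using cell_quantile_cell[OF j A] by (simp only: measure_empty)
    moreover have "{u \<in> {0..1}. cell_quantile N g u \<in> ?A \<and> \<lfloor>real N * u\<rfloor> = j}
      = (cell_quantile N g -` ?A \<inter> space unit_leb) \<inter> {u \<in> {0..1}. \<lfloor>real N * u\<rfloor> = j}"
      by auto
    moreover have "\<dots> \<in> sets unit_leb"
      using measurable_sets[OF qm A] unit_cell_sets by (rule sets.Int)
    ultimately have "AE u in unit_leb. u \<notin> {u \<in> {0..1}. cell_quantile N g u \<in> ?A \<and> \<lfloor>real N * u\<rfloor> = j}"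
      by (simp only: unit_leb.prob_eq_0)
    then show "AE u in unit_leb. \<not> (\<lfloor>real N * g (cell_quantile N g u)\<rfloor> \<noteq> j \<and> \<lfloor>real N * u\<rfloor> = j)"
      using AE_space by eventually_elim (use measurable_space[OF qm] in auto)
  qed simp
  \<comment> \<open>The point 1 carries the index N, which is not one of the N cells.\<close>
  moreover have "AE u in unit_leb. u \<noteq> 1"
    by (rule AE_restrict_space_iff[THEN iffD2]) (use AE_lborel_singleton[of "1::real"] in auto)
  ultimately show ?thesis using AE_space
  proof eventually_elim
    case (elim u)
    then have "\<lfloor>real N * u\<rfloor> \<in> {0..<int N}" by (intro floor_cell_range[OF N]) auto
    with elim show ?case by auto
  qed
qed

lemma distr_cell_quantile: "distr unit_leb unit_leb (cell_quantile N g) = unit_leb"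
proof (rule measure_eqI)
  let ?q = "cell_quantile N g"
  note qm = cell_quantile_measurable
  fix A assume "A \<in> sets (distr unit_leb unit_leb ?q)"
  then have A: "A \<in> sets unit_leb" by simp
  let ?C = "\<lambda>j. {u \<in> {0..1}. \<lfloor>real N * u\<rfloor> = j}" and ?D = "\<lambda>j. {s \<in> {0..1}. \<lfloor>real N * g s\<rfloor> = j}"
  note C = unit_cell_sets
  have D1: "unit_leb.prob (?D j) = cell_mass N g j 1" for j
    unfolding cell_mass_def by (rule arg_cong[where f="unit_leb.prob"]) auto
  have C1: "unit_leb.prob (?C j) = cell_mass N g j 1" if "j \<in> {0..<int N}" for j
  proof -
    have "{u \<in> {0..1}. ?q u \<in> {0..1} \<and> \<lfloor>real N * u\<rfloor> = j} = ?C j"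
      using measurable_space[OF qm] by auto
    moreover have "{s \<in> {0..1}. s \<in> {0..1} \<and> \<lfloor>real N * g s\<rfloor> = j} = ?D j" by auto
    ultimately show ?thesis
      using cell_quantile_cell[OF that, of "{0..1}"] D1 by (simp add: sets_unit_leb)
  qed
  have "unit_leb.prob (?q -` A \<inter> {0..1}) = (\<Sum>j\<in>{0..<int N}. unit_leb.prob ((?q -` A \<inter> {0..1}) \<inter> ?C j))"
    using C C1 sum_cell_mass measurable_sets[OF qm A] disjoint_cells[of "\<lambda>u. u"]
    by (intro unit_leb.prob_partition) auto
  also have "\<dots> = (\<Sum>j\<in>{0..<int N}. unit_leb.prob (A \<inter> ?D j))"
  proof (rule sum.cong)
    fix j assume j: "j \<in> {0..<int N}"
    have "(?q -` A \<inter> {0..1}) \<inter> ?C j = {u \<in> {0..1}. ?q u \<in> A \<and> \<lfloor>real N * u\<rfloor> = j}"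
      "A \<inter> ?D j = {s \<in> {0..1}. s \<in> A \<and> \<lfloor>real N * g s\<rfloor> = j}" by auto
    then show "unit_leb.prob ((?q -` A \<inter> {0..1}) \<inter> ?C j) = unit_leb.prob (A \<inter> ?D j)"
      using cell_quantile_cell[OF j A] by simp
  qed simp
  also have "\<dots> = unit_leb.prob A"
    using cell_sets D1 sum_cell_mass A disjoint_cells[of g]
    by (intro unit_leb.prob_partition[symmetric]) auto
  finally show "emeasure (distr unit_leb unit_leb ?q) A = emeasure unit_leb A"
    using A qm by (simp add: emeasure_distr unit_leb.emeasure_eq_measure)
qed simp

end

text \<open>The identity as default value makes this true for the exceptional fibres as well. The
  maps built from it therefore preserve measure on every fibre, and their symmetry is not disturbed
  by corrections on a null set.\<close>

lemma cell_quantile_preserves: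
  "distr unit_leb unit_leb (cell_quantile N g) = unit_leb"
proof (cases "equidistributed N g")
  case False
  then have "cell_quantile N g = (\<lambda>u. u)" by (auto simp: cell_quantile_def)
  then show ?thesis by simp
qed (rule distr_cell_quantile)

end

section \<open>Approximate right inverses of structure preserving maps\<close>

text \<open>The construction makes no choice and sees only the values of \<open>g\<close> on the
  unit interval. Both locality and commutation with permutations of the maps built from it rest on
  this.\<close>

lemma cell_quantile_cong:
  assumes "\<And>t. t \<in> {0..1} \<Longrightarrow> g t = g' t"
  shows "cell_quantile N g = cell_quantile N g'"
proof -
  have "{s \<in> {0..1}. s \<le> t \<and> \<lfloor>real N * g s\<rfloor> = j} = {s \<in> {0..1}. s \<le> t \<and> \<lfloor>real N * g' s\<rfloor> = j}" for j t
    using assms by auto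
  then have "cell_mass N g = cell_mass N g'" by (intro ext) (simp only: cell_mass_def)
  then show ?thesis by (intro ext) (simp add: cell_quantile_def equidistributed_def)
qed

definition fibre_quantile :: "nat \<Rightarrow> ((nat set \<Rightarrow> real) \<Rightarrow> (nat set \<Rightarrow> real)) \<Rightarrow> nat set \<Rightarrow> (nat set \<Rightarrow> real) \<Rightarrow> real \<Rightarrow> real" where
  "fibre_quantile N \<psi> S y = cell_quantile N (\<lambda>t. \<psi> (y(S := t)) S)"

text \<open>The set \<open>\<T>\<close> is a parameter because two requirements differ: preservation
  of measure is proved by adding one coordinate at a time, whereas commutation with permutations
  needs a full level, all of it computed from the same \<open>y\<close>.\<close>

definition quantile_map :: "nat \<Rightarrow> nat \<Rightarrow> ((nat set \<Rightarrow> real) \<Rightarrow> (nat set \<Rightarrow> real)) \<Rightarrow> nat set set \<Rightarrow>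
    (nat set \<Rightarrow> real) \<Rightarrow> (nat set \<Rightarrow> real)" where
  "quantile_map k N \<psi> \<T> y =
     (\<lambda>S\<in>rsets {1..k}. if S \<in> \<T> then fibre_quantile N \<psi> S y (y S) else y S)"

lemma fibre_quantile_upd [simp]: "fibre_quantile N \<psi> S (y(S := t)) = fibre_quantile N \<psi> S y"
  by (simp add: fibre_quantile_def)

lemma perm_image_rsets:
  assumes "\<sigma> permutes {1..k}" "S \<in> rsets {1..k}"
  shows "\<sigma> ` S \<in> rsets {1..k}" "card (\<sigma> ` S) = card S"
  using assms permutes_image[OF assms(1)] card_image[OF permutes_inj_on[OF assms(1)]]
  by (auto simp: rsets_def)

lemma perm_map_space:
  assumes "\<sigma> permutes {1..k}" "x \<in> space (Xk k)"
  shows "perm_map k \<sigma> x \<in> space (Xk k)"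
  using Xk_range[OF assms(2) perm_image_rsets(1)[OF assms(1)]] by (auto simp: perm_map_def space_Xk)

context
  fixes k N :: nat and \<psi> :: "(nat set \<Rightarrow> real) \<Rightarrow> (nat set \<Rightarrow> real)"
  assumes N: "N > 0" and sp: "structure_preserving k \<psi>"
begin

lemma cell_partition_fibre:
  assumes "S \<in> rsets {1..k}" "y \<in> space (Xk k)"
  shows "cell_partition N (\<lambda>t. \<psi> (y(S := t)) S)"
  using N measurable_fibre[OF assms(1) structure_preserving_measurable[OF sp] assms(2)]
  by unfold_locales

lemma fibre_quantile_local:
  assumes S: "S \<in> rsets {1..k}" and y: "y \<in> space (Xk k)" "y' \<in> space (Xk k)"
    and eq: "\<And>T. T \<in> rsets S \<Longrightarrow> T \<noteq> S \<Longrightarrow> y T = y' T"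
  shows "fibre_quantile N \<psi> S y = fibre_quantile N \<psi> S y'"
  unfolding fibre_quantile_def
proof (rule cell_quantile_cong)
  fix t :: real assume t: "t \<in> {0..1}"
  show "\<psi> (y(S := t)) S = \<psi> (y'(S := t)) S"
    by (rule local_mapD[OF structure_preserving_local[OF sp] S]) (use Xk_fun_upd[OF _ S t] y eq in auto)
qed

lemma measurable_fibre_quantile:
  assumes S: "S \<in> rsets {1..k}"
  shows "(\<lambda>y. fibre_quantile N \<psi> S y (y S)) \<in> measurable (Xk k) unit_leb"
  using measurable_cell_quantile[OF N measurable_fibre_pair[OF S structure_preserving_measurable[OF sp]]
      measurable_Xk_component[OF S]]
  by (simp add: fibre_quantile_def)

lemma measurable_quantile_map: "quantile_map k N \<psi> \<T> \<in> measurable (Xk k) (Xk k)"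
proof (rule measurable_into_Xk)
  fix S assume S: "S \<in> rsets {1..k}"
  show "(\<lambda>y. quantile_map k N \<psi> \<T> y S) \<in> measurable (Xk k) unit_leb"
    using S measurable_fibre_quantile[OF S] measurable_Xk_component[OF S]
    by (cases "S \<in> \<T>") (simp_all add: quantile_map_def)
qed (simp add: quantile_map_def)

lemma quantile_map_single:
  assumes "S \<in> rsets {1..k}" "y \<in> space (Xk k)"
  shows "quantile_map k N \<psi> {S} y = y(S := fibre_quantile N \<psi> S y (y S))"
proof
  fix T show "quantile_map k N \<psi> {S} y T = (y(S := fibre_quantile N \<psi> S y (y S))) T"
    using assms by (auto simp: quantile_map_def space_Xk PiE_iff extensional_def)
qed

lemma fibre_quantile_preserves:
  assumes "S \<in> rsets {1..k}" "y \<in> space (Xk k)"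
  shows "fibre_quantile N \<psi> S y \<in> measurable unit_leb unit_leb"
    and "distr unit_leb unit_leb (fibre_quantile N \<psi> S y) = unit_leb"
  unfolding fibre_quantile_def
  using cell_partition.cell_quantile_measurable[OF cell_partition_fibre[OF assms]]
    cell_partition.cell_quantile_preserves[OF cell_partition_fibre[OF assms]] .

text \<open>With the other coordinates fixed, the coordinate \<open>S\<close> is moved by a measure
  preserving map of the interval; integrate over the fibres.\<close>

lemma distr_quantile_map_single:
  assumes S: "S \<in> rsets {1..k}"
  shows "distr (Xk k) (Xk k) (quantile_map k N \<psi> {S}) = Xk k"
proof (rule measure_eqI)
  let ?R = "quantile_map k N \<psi> {S}"
  fix B assume "B \<in> sets (distr (Xk k) (Xk k) ?R)"
  then have B: "B \<in> sets (Xk k)" by simp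
  have RB: "?R -` B \<inter> space (Xk k) \<in> sets (Xk k)"
    using measurable_sets[OF measurable_quantile_map B] .
  have "emeasure (distr (Xk k) (Xk k) ?R) B = emeasure (Xk k) (?R -` B \<inter> space (Xk k))"
    using B by (rule emeasure_distr[OF measurable_quantile_map])
  also have "\<dots> = (\<integral>\<^sup>+x. emeasure unit_leb {t \<in> {0..1}. x(S := t) \<in> ?R -` B \<inter> space (Xk k)} \<partial>Xk k)"
    by (rule emeasure_resample[OF S RB])
  also have "\<dots> = (\<integral>\<^sup>+x. emeasure unit_leb {t \<in> {0..1}. x(S := t) \<in> B} \<partial>Xk k)"
  proof (rule nn_integral_cong)
    fix x assume x: "x \<in> space (Xk k)"
    let ?q = "fibre_quantile N \<psi> S x"
    have "{t \<in> {0..1}. x(S := t) \<in> ?R -` B \<inter> space (Xk k)} = ?q -` {t \<in> {0..1}. x(S := t) \<in> B} \<inter> space unit_leb"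
      using Xk_fun_upd[OF x S] quantile_map_single[OF S Xk_fun_upd[OF x S]]
        measurable_space[OF fibre_quantile_preserves(1)[OF S x]] by auto
    then show "emeasure unit_leb {t \<in> {0..1}. x(S := t) \<in> ?R -` B \<inter> space (Xk k)}
      = emeasure unit_leb {t \<in> {0..1}. x(S := t) \<in> B}"
      using emeasure_distr[OF fibre_quantile_preserves(1)[OF S x] measurable_section[OF S B x]]
        fibre_quantile_preserves(2)[OF S x] by simp
  qed
  also have "\<dots> = emeasure (Xk k) B" by (rule emeasure_resample[OF S B, symmetric])
  finally show "emeasure (distr (Xk k) (Xk k) ?R) B = emeasure (Xk k) B" .
qed simp

text \<open>The fibre quantile at \<open>S\<close> reads only the coordinates of proper subsets of
  \<open>S\<close>, and \<open>\<T>\<close> contains none of these, so the simultaneous change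
  splits into two successive ones.\<close>

lemma quantile_map_insert:
  assumes S: "S \<in> rsets {1..k}" "S \<notin> \<T>" and \<T>: "\<And>T. T \<in> \<T> \<Longrightarrow> \<not> T \<subset> S" and y: "y \<in> space (Xk k)"
  shows "quantile_map k N \<psi> (insert S \<T>) y = quantile_map k N \<psi> {S} (quantile_map k N \<psi> \<T> y)"
proof -
  let ?z = "quantile_map k N \<psi> \<T> y"
  have z: "?z \<in> space (Xk k)" using measurable_space[OF measurable_quantile_map y] .
  have "fibre_quantile N \<psi> S ?z = fibre_quantile N \<psi> S y"
  proof (rule fibre_quantile_local[OF S(1) z y])
    fix T assume "T \<in> rsets S" "T \<noteq> S"
    then show "?z T = y T"
      using S(1) \<T> by (auto simp: quantile_map_def rsets_def)
  qed
  moreover have "?z S = y S" using S by (simp add: quantile_map_def)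
  ultimately show ?thesis
    using S by (auto simp: quantile_map_single[OF S(1) z] quantile_map_def)
qed

lemma distr_quantile_map:
  assumes "\<T> \<subseteq> {S \<in> rsets {1..k}. card S = s}"
  shows "distr (Xk k) (Xk k) (quantile_map k N \<psi> \<T>) = Xk k"
proof -
  have "finite \<T>" using assms by (rule finite_subset) simp
  then show ?thesis using assms
  proof (induction \<T> rule: finite_induct)
    case empty
    have "distr (Xk k) (Xk k) (quantile_map k N \<psi> {}) = distr (Xk k) (Xk k) (\<lambda>y. y)"
      by (rule distr_cong) (auto simp: quantile_map_def space_Xk PiE_iff extensional_restrict)
    then show ?case by simp
  next
    case (insert S \<T>)
    have S: "S \<in> rsets {1..k}" using insert by auto
    have fin: "finite S" using S by (auto simp: rsets_def intro: finite_subset)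
    \<comment> \<open>Sets of equal cardinality are never properly nested, so
      \<open>quantile_map_insert\<close> applies within a level.\<close>
    have sub: "\<not> T \<subset> S" if "T \<in> \<T>" for T
    proof -
      have "card T = card S" using that insert.prems by auto
      then show ?thesis using psubset_card_mono[OF fin, of T] by auto
    qed
    have "distr (Xk k) (Xk k) (quantile_map k N \<psi> (insert S \<T>))
      = distr (Xk k) (Xk k) (quantile_map k N \<psi> {S} \<circ> quantile_map k N \<psi> \<T>)"
      by (rule distr_cong) (simp_all add: quantile_map_insert[OF S insert.hyps(2) sub])
    also have "\<dots> = Xk k"
      using distr_distr[OF measurable_quantile_map measurable_quantile_map, of \<T> "{S}"]
        distr_quantile_map_single[OF S] insert.IH insert.prems by simp
    finally show ?case .
  qed
qed

lemma perm_map_upd: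
  assumes "\<sigma> permutes {1..k}" "S \<in> rsets {1..k}"
  shows "(perm_map k \<sigma> y)(S := t) = perm_map k \<sigma> (y(\<sigma> ` S := t))"
proof
  fix T
  have "\<sigma> ` T = \<sigma> ` S \<longleftrightarrow> T = S" using permutes_inj[OF assms(1)] by (simp add: inj_image_eq_iff)
  then show "((perm_map k \<sigma> y)(S := t)) T = perm_map k \<sigma> (y(\<sigma> ` S := t)) T"
    using assms(2) by (auto simp: perm_map_def)
qed

text \<open>A level is stable under permutations. As \<open>\<psi>\<close> commutes with them, its
  fibre at \<open>S\<close> over a permuted point is its fibre at the permuted set over the original
  point, and a canonical quantile inherits this symmetry.\<close>

lemma structure_preserving_quantile_map:
  defines "\<T> s \<equiv> {S \<in> rsets {1..k}. card S = s}"
  shows "structure_preserving k (quantile_map k N \<psi> (\<T> s))"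
proof (rule structure_preservingI)
  let ?R = "quantile_map k N \<psi> (\<T> s)"
  show "?R \<in> measurable (Xk k) (Xk k)" by (rule measurable_quantile_map)
  show "distr (Xk k) (Xk k) ?R = Xk k" by (rule distr_quantile_map[of _ s]) (simp add: \<T>_def)
  show "?R (perm_map k \<sigma> x) = perm_map k \<sigma> (?R x)"
    if \<sigma>: "\<sigma> permutes {1..k}" and x: "x \<in> space (Xk k)" for \<sigma> x
  proof
    fix S
    show "?R (perm_map k \<sigma> x) S = perm_map k \<sigma> (?R x) S"
    proof (cases "S \<in> rsets {1..k}")
      case S: True
      note im = perm_image_rsets[OF \<sigma> S]
      have "fibre_quantile N \<psi> S (perm_map k \<sigma> x) = fibre_quantile N \<psi> (\<sigma> ` S) x"
        unfolding fibre_quantile_def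
      proof (rule cell_quantile_cong)
        fix t :: real assume "t \<in> {0..1}"
        then have "\<psi> (perm_map k \<sigma> (x(\<sigma> ` S := t))) = perm_map k \<sigma> (\<psi> (x(\<sigma> ` S := t)))"
          by (intro structure_preserving_perm_map[OF sp \<sigma>] Xk_fun_upd[OF x im(1)])
        then show "\<psi> ((perm_map k \<sigma> x)(S := t)) S = \<psi> (x(\<sigma> ` S := t)) (\<sigma> ` S)"
          using S unfolding perm_map_upd[OF \<sigma> S] by (simp add: perm_map_def[of k \<sigma> "\<psi> _"])
      qed
      then show ?thesis using S im by (simp add: quantile_map_def \<T>_def perm_map_def)
    qed (simp add: quantile_map_def perm_map_def)
  qed
  show "local_map k ?R"
    unfolding local_map_def
  proof (intro ballI impI)
    fix S x y assume S: "S \<in> rsets {1..k}" and xy: "x \<in> space (Xk k)" "y \<in> space (Xk k)"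
      and eq: "\<forall>T\<in>rsets S. x T = y T"
    then show "?R x S = ?R y S"
      using fibre_quantile_local[OF S xy] rsets_self[OF S] by (auto simp: quantile_map_def)
  qed
  fix S assume S: "S \<in> rsets {1..k}"
  show "AE x in Xk k. distr unit_leb unit_leb (\<lambda>t. ?R (x(S := t)) S) = unit_leb"
  proof (rule AE_I2)
    fix x assume x: "x \<in> space (Xk k)"
    show "distr unit_leb unit_leb (\<lambda>t. ?R (x(S := t)) S) = unit_leb"
      using fibre_quantile_preserves(2)[OF S x] S
      by (cases "S \<in> \<T> s") (simp_all add: quantile_map_def)
  qed
qed

text \<open>Resampling the coordinate \<open>S\<close> leaves the fibre quantile at \<open>S\<close>
  unchanged, so the claim reduces to the one-dimensional \<open>AE_cell_quantile\<close> on almost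
  every fibre.\<close>

lemma AE_fibre_quantile:
  assumes S: "S \<in> rsets {1..k}"
  shows "AE y in Xk k. \<lfloor>real N * \<psi> (y(S := fibre_quantile N \<psi> S y (y S))) S\<rfloor> = \<lfloor>real N * y S\<rfloor>"
proof (rule AE_resample[OF S])
  note m = structure_preserving_measurable[OF sp]
  have "(\<lambda>y. \<psi> (y(S := fibre_quantile N \<psi> S y (y S))) S) \<in> borel_measurable (Xk k)"
    by (rule measurable_unit_leb_borel, rule measurable_compose[OF measurable_compose[OF
        measurable_Xk_upd[OF S _ measurable_fibre_quantile[OF S]] m] measurable_Xk_component[OF S]]) simp
  moreover have "(\<lambda>y. y S) \<in> borel_measurable (Xk k)"
    by (rule measurable_unit_leb_borel[OF measurable_Xk_component[OF S]])
  ultimately show "{y \<in> space (Xk k). \<lfloor>real N * \<psi> (y(S := fibre_quantile N \<psi> S y (y S))) S\<rfloor> = \<lfloor>real N * y S\<rfloor>} \<in> sets (Xk k)"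
    by measurable
  show "AE x in Xk k. AE t in unit_leb. \<lfloor>real N * \<psi> ((x(S := t))(S := fibre_quantile N \<psi> S (x(S := t)) ((x(S := t)) S))) S\<rfloor>
      = \<lfloor>real N * (x(S := t)) S\<rfloor>"
    using structure_preserving_fibre[OF sp S] AE_space
  proof eventually_elim
    case (elim x)
    note loc = cell_partition_fibre[OF S elim(2)]
    from cell_partition.AE_cell_quantile[OF loc cell_partition.equidistributed_if_distr[OF loc elim(1)]]
    show ?case by (simp add: fibre_quantile_def)
  qed
qed

text \<open>The second clause keeps the larger coordinates intact until their turn: the map for
  level \<open>Suc s\<close> matches the coordinates of \<open>\<rho> x\<close>, and on that level
  these are still the coordinates of \<open>x\<close>. Since the level map moves nothing below,
  locality of \<open>\<psi>\<close> preserves what has been achieved.\<close>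

lemma approximate_right_inverse_level:
  "\<exists>\<rho>. structure_preserving k \<rho> \<and>
    (\<forall>x\<in>space (Xk k). \<forall>S\<in>rsets {1..k}. card S > s \<longrightarrow> \<rho> x S = x S) \<and>
    (AE x in Xk k. \<forall>S\<in>rsets {1..k}. card S \<le> s \<longrightarrow> \<lfloor>real N * \<psi> (\<rho> x) S\<rfloor> = \<lfloor>real N * x S\<rfloor>)"
proof (induction s)
  case 0
  \<comment> \<open>Members of \<open>rsets\<close> are nonempty, so level 0 is vacuous and the
    identity starts the induction.\<close>
  have pos: "card S \<noteq> 0" if "S \<in> rsets {1..k}" for S
    using that finite_subset[of S "{1..k}"] by (auto simp: rsets_def)
  have "AE x in Xk k. \<forall>S\<in>rsets {1..k}. card S \<le> 0 \<longrightarrow> \<lfloor>real N * \<psi> x S\<rfloor> = \<lfloor>real N * x S\<rfloor>"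
  proof (rule AE_I2, intro ballI impI)
    fix x S assume "S \<in> rsets {1..k}" "card S \<le> 0"
    with pos[of S] show "\<lfloor>real N * \<psi> x S\<rfloor> = \<lfloor>real N * x S\<rfloor>" by simp
  qed
  then show ?case by (intro exI[of _ "\<lambda>x. x"]) (simp add: structure_preserving_id)
next
  case (Suc s)
  then obtain \<rho> where \<rho>: "structure_preserving k \<rho>"
    and above: "\<And>x S. x \<in> space (Xk k) \<Longrightarrow> S \<in> rsets {1..k} \<Longrightarrow> card S > s \<Longrightarrow> \<rho> x S = x S"
    and AE: "AE x in Xk k. \<forall>S\<in>rsets {1..k}. card S \<le> s \<longrightarrow> \<lfloor>real N * \<psi> (\<rho> x) S\<rfloor> = \<lfloor>real N * x S\<rfloor>"
    by auto
  define \<T> where "\<T> = {S \<in> rsets {1..k}. card S = Suc s}"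
  let ?R = "quantile_map k N \<psi> \<T>"
  note m = structure_preserving_measurable[OF \<rho>]
  have R: "structure_preserving k ?R" unfolding \<T>_def by (rule structure_preserving_quantile_map)
  \<comment> \<open>Among the subsets of \<open>S\<close>, the full level map moves only the
    coordinate \<open>S\<close>, so a local \<open>\<psi>\<close> evaluated at \<open>S\<close>
    cannot tell it from the change at \<open>S\<close> alone.\<close>
  have agree: "?R y T = (y(S := fibre_quantile N \<psi> S y (y S))) T"
    if S: "S \<in> \<T>" and T: "T \<in> rsets S" for S T y
  proof (cases "T = S")
    case False
    have "finite S" using S by (auto simp: \<T>_def rsets_def intro: finite_subset)
    then have "card T < card S" using False T by (auto simp: rsets_def intro: psubset_card_mono)
    then show ?thesis using S T False rsets_in_rsets[of S "{1..k}"] by (auto simp: quantile_map_def \<T>_def)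
  qed (use S in \<open>auto simp: quantile_map_def \<T>_def\<close>)
  have agree': "?R y T = y T" if S: "S \<in> rsets {1..k}" "card S \<le> s" and T: "T \<in> rsets S" for S T y
  proof -
    have "finite S" using S by (auto simp: rsets_def intro: finite_subset)
    then have "card T \<le> card S" using T by (auto simp: rsets_def intro: card_mono)
    then show ?thesis using S T rsets_in_rsets[of S "{1..k}"] by (auto simp: quantile_map_def \<T>_def)
  qed
  have "AE y in Xk k. \<forall>S\<in>\<T>. \<lfloor>real N * \<psi> (?R y) S\<rfloor> = \<lfloor>real N * y S\<rfloor>"
  proof (rule AE_finite_allI)
    show "finite \<T>" by (simp add: \<T>_def)
    fix S assume S: "S \<in> \<T>"
    then have S': "S \<in> rsets {1..k}" by (simp add: \<T>_def)
    show "AE y in Xk k. \<lfloor>real N * \<psi> (?R y) S\<rfloor> = \<lfloor>real N * y S\<rfloor>"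
      using AE_fibre_quantile[OF S'] AE_space
    proof eventually_elim
      case (elim y)
      have "\<psi> (?R y) S = \<psi> (y(S := fibre_quantile N \<psi> S y (y S))) S"
      proof (rule local_mapD[OF structure_preserving_local[OF sp] S'])
        show "?R y \<in> space (Xk k)" by (rule measurable_space[OF measurable_quantile_map elim(2)])
        show "y(S := fibre_quantile N \<psi> S y (y S)) \<in> space (Xk k)"
          by (rule Xk_fun_upd[OF elim(2) S' measurable_space[OF measurable_fibre_quantile[OF S'] elim(2), unfolded space_unit_leb]])
      qed (rule agree[OF S])
      with elim show ?case by simp
    qed
  qed
  \<comment> \<open>The claim for almost every \<open>y\<close> is used at
    \<open>y = \<rho> x\<close>; preimages of null sets under \<open>\<rho>\<close> are
    null.\<close>
  from structure_preserving_AE[OF \<rho> this]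
  have "AE x in Xk k. \<forall>S\<in>\<T>. \<lfloor>real N * \<psi> (?R (\<rho> x)) S\<rfloor> = \<lfloor>real N * \<rho> x S\<rfloor>" .
  with AE have "AE x in Xk k. \<forall>S\<in>rsets {1..k}. card S \<le> Suc s \<longrightarrow> \<lfloor>real N * \<psi> (?R (\<rho> x)) S\<rfloor> = \<lfloor>real N * x S\<rfloor>"
    using AE_space
  proof eventually_elim
    case (elim x)
    have \<rho>x: "\<rho> x \<in> space (Xk k)" by (rule measurable_space[OF m elim(3)])
    show ?case
    proof (intro ballI impI)
      fix S assume S: "S \<in> rsets {1..k}" "card S \<le> Suc s"
      show "\<lfloor>real N * \<psi> (?R (\<rho> x)) S\<rfloor> = \<lfloor>real N * x S\<rfloor>"
      proof (cases "card S = Suc s")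
        case True
        then have "S \<in> \<T>" using S by (simp add: \<T>_def)
        then show ?thesis using elim(2) above[OF elim(3) S(1)] True by simp
      next
        case False
        with S have le: "card S \<le> s" by simp
        have "\<psi> (?R (\<rho> x)) S = \<psi> (\<rho> x) S"
          by (rule local_mapD[OF structure_preserving_local[OF sp] S(1) _ \<rho>x])
            (use agree'[OF S(1) le] measurable_space[OF measurable_quantile_map \<rho>x] in auto)
        then show ?thesis using elim(1) S(1) le by simp
      qed
    qed
  qed
  moreover have "?R (\<rho> x) S = x S" if "x \<in> space (Xk k)" "S \<in> rsets {1..k}" "card S > Suc s" for x S
    using that above[of x S] by (simp add: quantile_map_def \<T>_def)
  ultimately show ?case
    using structure_preserving_compose[OF \<rho> R] by (intro exI[of _ "\<lambda>x. ?R (\<rho> x)"]) auto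
qed

lemma approximate_right_inverse:
  obtains \<rho> where "structure_preserving k \<rho>"
    "AE x in Xk k. \<forall>S\<in>rsets {1..k}. \<lfloor>real N * \<psi> (\<rho> x) S\<rfloor> = \<lfloor>real N * x S\<rfloor>"
proof -
  have "card S \<le> k" if "S \<in> rsets {1..k}" for S
    using that card_mono[of "{1..k}" S] by (auto simp: rsets_def)
  then show ?thesis using approximate_right_inverse_level[of k] that by auto
qed

end

section \<open>Approximation by unions of grid cells\<close>

lemma d1_nonneg: "0 \<le> d1 k U W"
  by (simp add: d1_def)

lemma d1_commute: "d1 k U W = d1 k W U"
  by (simp add: d1_def Un_commute)

lemma d1_refl [simp]: "d1 k U U = 0"
  by (simp add: d1_def)

lemma d1_mono:
  assumes "U \<in> sets (Xk k)" "W \<in> sets (Xk k)" "A \<in> sets (Xk k)" "sym_diff U W \<subseteq> A"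
  shows "d1 k U W \<le> Xk.prob k A"
  unfolding d1_def using assms by (intro Xk.finite_measure_mono) auto

lemma d1_triangle:
  assumes "U \<in> sets (Xk k)" "V \<in> sets (Xk k)" "W \<in> sets (Xk k)"
  shows "d1 k U W \<le> d1 k U V + d1 k V W"
proof -
  have "d1 k U W \<le> Xk.prob k (sym_diff U V \<union> sym_diff V W)"
    using assms by (intro d1_mono) auto
  also have "\<dots> \<le> d1 k U V + d1 k V W"
    unfolding d1_def using assms by (intro measure_Un_le) auto
  finally show ?thesis .
qed

lemma d1_Un:
  assumes "U \<in> sets (Xk k)" "V \<in> sets (Xk k)" "U' \<in> sets (Xk k)" "V' \<in> sets (Xk k)"
  shows "d1 k (U \<union> V) (U' \<union> V') \<le> d1 k U U' + d1 k V V'"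
proof -
  have "d1 k (U \<union> V) (U' \<union> V') \<le> Xk.prob k (sym_diff U U' \<union> sym_diff V V')"
    using assms by (intro d1_mono) auto
  also have "\<dots> \<le> d1 k U U' + d1 k V V'"
    unfolding d1_def using assms by (intro measure_Un_le) auto
  finally show ?thesis .
qed

text \<open>For positive N, a union of cells of the grid of mesh 1/N. Faces on which some coordinate
  equals 1 form further, degenerate cells, because the floor jumps to N there.\<close>

definition grid_set :: "nat \<Rightarrow> nat \<Rightarrow> (nat set \<Rightarrow> real) set \<Rightarrow> bool" where
  "grid_set k N G \<longleftrightarrow> G \<in> sets (Xk k) \<and> (\<forall>x\<in>G. \<forall>y\<in>space (Xk k).
     (\<forall>S\<in>rsets {1..k}. \<lfloor>real N * x S\<rfloor> = \<lfloor>real N * y S\<rfloor>) \<longrightarrow> y \<in> G)"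

lemma grid_setI:
  assumes "G \<in> sets (Xk k)"
    and "\<And>x y. x \<in> G \<Longrightarrow> y \<in> space (Xk k) \<Longrightarrow>
      (\<And>S. S \<in> rsets {1..k} \<Longrightarrow> \<lfloor>real N * x S\<rfloor> = \<lfloor>real N * y S\<rfloor>) \<Longrightarrow> y \<in> G"
  shows "grid_set k N G"
  using assms unfolding grid_set_def by blast

lemma grid_setD:
  assumes "grid_set k N G" "x \<in> G" "y \<in> space (Xk k)"
    "\<And>S. S \<in> rsets {1..k} \<Longrightarrow> \<lfloor>real N * x S\<rfloor> = \<lfloor>real N * y S\<rfloor>"
  shows "y \<in> G"
  using assms unfolding grid_set_def by blast

lemma grid_set_sets: "grid_set k N G \<Longrightarrow> G \<in> sets (Xk k)"
  by (simp add: grid_set_def)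

text \<open>The index in the coarse grid is the index in the fine grid divided by \<open>M\<close>.
  This brings sets of two meshes to a common one, as a union requires.\<close>

lemma grid_set_refine:
  assumes G: "grid_set k N G" and M: "M > 0"
  shows "grid_set k (N * M) G"
proof (rule grid_setI[OF grid_set_sets[OF G]])
  have fl: "\<lfloor>real N * t\<rfloor> = \<lfloor>real (N * M) * t\<rfloor> div int M" for t
    using floor_divide_real_eq_div[of "int M" "real (N * M) * t"] M by (simp add: field_simps)
  fix x y assume "x \<in> G" "y \<in> space (Xk k)"
    and eq: "\<And>S. S \<in> rsets {1..k} \<Longrightarrow> \<lfloor>real (N * M) * x S\<rfloor> = \<lfloor>real (N * M) * y S\<rfloor>"
  then show "y \<in> G"
    using grid_setD[OF G] by (metis fl)
qed

lemma grid_set_Un: "grid_set k N G \<Longrightarrow> grid_set k N H \<Longrightarrow> grid_set k N (G \<union> H)"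
  unfolding grid_set_def by blast

lemma grid_set_compl:
  assumes "grid_set k N G"
  shows "grid_set k N (space (Xk k) - G)"
proof (rule grid_setI)
  show "space (Xk k) - G \<in> sets (Xk k)" using grid_set_sets[OF assms] by auto
  fix x y assume x: "x \<in> space (Xk k) - G" and y: "y \<in> space (Xk k)"
    and eq: "\<And>S. S \<in> rsets {1..k} \<Longrightarrow> \<lfloor>real N * x S\<rfloor> = \<lfloor>real N * y S\<rfloor>"
  have "y \<notin> G"
  proof
    assume "y \<in> G"
    then have "x \<in> G" by (rule grid_setD[OF assms]) (use x eq in auto)
    then show False using x by simp
  qed
  then show "y \<in> space (Xk k) - G" using y by simp
qed

definition grid_approximable :: "nat \<Rightarrow> (nat set \<Rightarrow> real) set \<Rightarrow> bool" where
  "grid_approximable k E \<longleftrightarrow> E \<in> sets (Xk k) \<and> (\<forall>e>0. \<exists>N>0. \<exists>G. grid_set k N G \<and> d1 k E G < e)"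

lemma grid_approximableE:
  assumes "grid_approximable k E" "0 < e"
  obtains N G where "N > 0" "grid_set k N G" "d1 k E G < e"
  using assms unfolding grid_approximable_def by blast

lemma grid_approximable_sets: "grid_approximable k E \<Longrightarrow> E \<in> sets (Xk k)"
  by (simp add: grid_approximable_def)

lemma grid_approximable_compl:
  assumes E: "grid_approximable k E"
  shows "grid_approximable k (space (Xk k) - E)"
  unfolding grid_approximable_def
proof (intro conjI allI impI)
  show "space (Xk k) - E \<in> sets (Xk k)" using grid_approximable_sets[OF E] by auto
  fix e :: real assume "0 < e"
  with E obtain N G where G: "N > 0" "grid_set k N G" "d1 k E G < e" by (rule grid_approximableE)
  have "E \<subseteq> space (Xk k)" "G \<subseteq> space (Xk k)"
    using sets.sets_into_space grid_approximable_sets[OF E] grid_set_sets[OF G(2)] by blast+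
  then have "sym_diff (space (Xk k) - E) (space (Xk k) - G) = sym_diff E G" by auto
  then have "d1 k (space (Xk k) - E) (space (Xk k) - G) < e" using G(3) by (simp add: d1_def)
  then show "\<exists>N>0. \<exists>G. grid_set k N G \<and> d1 k (space (Xk k) - E) G < e"
    using grid_set_compl[OF G(2)] G(1) by blast
qed

lemma grid_approximable_Un:
  assumes E: "grid_approximable k E" and F: "grid_approximable k F"
  shows "grid_approximable k (E \<union> F)"
  unfolding grid_approximable_def
proof (intro conjI allI impI)
  show "E \<union> F \<in> sets (Xk k)" using E F by (auto dest: grid_approximable_sets)
  fix e :: real assume "0 < e"
  then have e: "0 < e / 2" by simp
  obtain N G where G: "N > 0" "grid_set k N G" "d1 k E G < e / 2" using E e by (rule grid_approximableE)
  obtain M H where H: "M > 0" "grid_set k M H" "d1 k F H < e / 2" using F e by (rule grid_approximableE)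
  have "grid_set k (N * M) (G \<union> H)"
    using grid_set_refine[OF G(2) H(1)] grid_set_refine[OF H(2) G(1)]
    by (intro grid_set_Un) (simp_all add: mult.commute)
  moreover have "d1 k (E \<union> F) (G \<union> H) < e"
    using d1_Un[OF grid_approximable_sets[OF E] grid_approximable_sets[OF F] grid_set_sets[OF G(2)] grid_set_sets[OF H(2)]]
      G(3) H(3) by linarith
  ultimately show "\<exists>N>0. \<exists>G. grid_set k N G \<and> d1 k (E \<union> F) G < e"
    using G(1) H(1) by (intro exI[of _ "N * M"]) auto
qed

lemma grid_approximable_empty: "grid_approximable k {}"
  unfolding grid_approximable_def
  by (auto intro!: exI[of _ "1::nat"] exI[of _ "{}"] grid_setI)

lemma grid_approximable_UN:
  assumes E: "\<And>i::nat. grid_approximable k (E i)"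
  shows "grid_approximable k (\<Union>i. E i)"
  unfolding grid_approximable_def
proof (intro conjI allI impI)
  have fin: "grid_approximable k (\<Union>i<n. E i)" for n
    by (induction n) (auto simp: grid_approximable_empty lessThan_Suc intro!: grid_approximable_Un E)
  show U: "(\<Union>i. E i) \<in> sets (Xk k)" using grid_approximable_sets[OF E] by auto
  fix e :: real assume "0 < e"
  \<comment> \<open>Continuity of measure reduces the countable union to a finite one, for which a
    common mesh exists.\<close>
  have "(\<lambda>n. Xk.prob k (\<Union>i<n. E i)) \<longlonglongrightarrow> Xk.prob k (\<Union>n. \<Union>i<n. E i)"
    using grid_approximable_sets[OF fin]
    by (intro Xk.finite_Lim_measure_incseq) (fastforce simp: incseq_def)+
  also have "(\<Union>n. \<Union>i<n. E i) = (\<Union>i. E i)" by blast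
  finally obtain n where n: "dist (Xk.prob k (\<Union>i<n. E i)) (Xk.prob k (\<Union>i. E i)) < e / 2"
    using \<open>0 < e\<close> by (metis half_gt_zero lim_sequentially le_refl)
  have "sym_diff (\<Union>i. E i) (\<Union>i<n. E i) = (\<Union>i. E i) - (\<Union>i<n. E i)" by blast
  then have "d1 k (\<Union>i. E i) (\<Union>i<n. E i) = Xk.prob k (\<Union>i. E i) - Xk.prob k (\<Union>i<n. E i)"
    unfolding d1_def using U grid_approximable_sets[OF fin] by (simp only: Xk.finite_measure_Diff UN_mono subset_UNIV order_refl)
  then have d: "d1 k (\<Union>i. E i) (\<Union>i<n. E i) < e / 2" using n unfolding dist_real_def by linarith
  obtain N G where G: "N > 0" "grid_set k N G" "d1 k (\<Union>i<n. E i) G < e / 2"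
    using grid_approximableE[OF fin[of n], of "e / 2"] \<open>0 < e\<close> by auto
  have "d1 k (\<Union>i. E i) G < e"
    using d1_triangle[OF U grid_approximable_sets[OF fin[of n]] grid_set_sets[OF G(2)]] d G(3) by linarith
  then show "\<exists>N>0. \<exists>G. grid_set k N G \<and> d1 k (\<Union>i. E i) G < e" using G by blast
qed

text \<open>Replacing \<open>a\<close> by the left end of its cell changes the half-space only
  inside the strip where the coordinate \<open>S\<close> lies in the cell of \<open>a\<close>, and
  this strip has measure at most 1/N.\<close>

lemma grid_approximable_halfspace:
  assumes S: "S \<in> rsets {1..k}"
  shows "grid_approximable k {x \<in> space (Xk k). x S < a}"
  unfolding grid_approximable_def
proof (intro conjI allI impI)
  have m: "(\<lambda>x. x S) \<in> borel_measurable (Xk k)"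
    by (rule measurable_unit_leb_borel[OF measurable_Xk_component[OF S]])
  then show H: "{x \<in> space (Xk k). x S < a} \<in> sets (Xk k)" by measurable
  fix e :: real assume "0 < e"
  then obtain N where N: "N > 0" "1 / real N < e" using ex_inverse_of_nat_less[of e] by (auto simp: inverse_eq_divide)
  let ?G = "{x \<in> space (Xk k). \<lfloor>real N * x S\<rfloor> < \<lfloor>real N * a\<rfloor>}"
  let ?I = "{of_int \<lfloor>real N * a\<rfloor> / real N..<of_int (\<lfloor>real N * a\<rfloor> + 1) / real N} \<inter> {0..1}"
  have I: "?I \<in> sets unit_leb" by (auto simp: sets_unit_leb)
  have Gs: "?G \<in> sets (Xk k)" using m by measurable
  then have G: "grid_set k N ?G" by (rule grid_setI) (use S in auto)
  let ?A = "{x \<in> space (Xk k). x S \<in> ?I}"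
  have "(\<lambda>x. x S) -` ?I \<inter> space (Xk k) \<in> sets (Xk k)"
    using measurable_sets[OF measurable_Xk_component[OF S] I] .
  moreover have "(\<lambda>x. x S) -` ?I \<inter> space (Xk k) = ?A" by auto
  ultimately have A: "?A \<in> sets (Xk k)" by simp
  have "sym_diff {x \<in> space (Xk k). x S < a} ?G \<subseteq> ?A"
  proof
    fix x assume x: "x \<in> sym_diff {x \<in> space (Xk k). x S < a} ?G"
    then have xs: "x \<in> space (Xk k)" by auto
    have "\<lfloor>real N * x S\<rfloor> = \<lfloor>real N * a\<rfloor>"
    proof (cases "x S < a")
      case True
      then have "real N * x S \<le> real N * a" by (simp add: mult_left_mono)
      then have "\<lfloor>real N * x S\<rfloor> \<le> \<lfloor>real N * a\<rfloor>" by (rule floor_mono)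
      then show ?thesis using x True by auto
    next
      case False
      then have "real N * a \<le> real N * x S" by (simp add: mult_left_mono)
      then have "\<lfloor>real N * a\<rfloor> \<le> \<lfloor>real N * x S\<rfloor>" by (rule floor_mono)
      then show ?thesis using x False by auto
    qed
    then have "x S \<in> {of_int \<lfloor>real N * a\<rfloor> / real N..<of_int (\<lfloor>real N * a\<rfloor> + 1) / real N}"
      by (rule floor_cell_iff[OF N(1), THEN iffD1])
    then show "x \<in> ?A" using Xk_range[OF xs S] xs by blast
  qed
  then have "d1 k {x \<in> space (Xk k). x S < a} ?G \<le> Xk.prob k ?A"
    by (rule d1_mono[OF H Gs A])
  also have "Xk.prob k ?A = unit_leb.prob ?I"
    using emeasure_Xk_component[OF S I] by (simp only: measure_def)
  also have "\<dots> = measure lborel ?I" by (rule measure_restrict_space) auto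
  also have "\<dots> \<le> measure lborel {of_int \<lfloor>real N * a\<rfloor> / real N..<of_int (\<lfloor>real N * a\<rfloor> + 1) / real N}"
    using N by (intro measure_mono_fmeasurable) (auto simp: fmeasurable_def divide_right_mono)
  also have "\<dots> = 1 / real N" using N by (simp add: field_simps)
  finally show "\<exists>N>0. \<exists>G. grid_set k N G \<and> d1 k {x \<in> space (Xk k). x S < a} G < e"
    using N G by (intro exI[of _ N] conjI exI[of _ ?G]) auto
qed

text \<open>The approximable sets form a sigma-algebra for which every coordinate is measurable, so
  the identity from it to the cube is measurable.\<close>

lemma grid_approximable:
  assumes "E \<in> sets (Xk k)"
  shows "grid_approximable k E"
proof -
  let ?\<A> = "{E. grid_approximable k E}"
  have "?\<A> \<subseteq> Pow (space (Xk k))" using grid_approximable_sets sets.sets_into_space by blast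
  then have "sigma_algebra (space (Xk k)) ?\<A>"
    unfolding sigma_algebra_iff2
    using grid_approximable_empty grid_approximable_compl grid_approximable_UN by (auto simp: image_subset_iff)
  then interpret A: sigma_algebra "space (Xk k)" ?\<A> .
  let ?M = "sigma (space (Xk k)) ?\<A>"
  have M: "space ?M = space (Xk k)" "sets ?M = ?\<A>" by auto
  have "(\<lambda>x. x) \<in> measurable ?M (Xk k)"
  proof (rule measurable_into_Xk)
    fix S assume S: "S \<in> rsets {1..k}"
    show "(\<lambda>x. x S) \<in> measurable ?M unit_leb"
    proof (rule measurable_unit_lebI)
      show "(\<lambda>x. x S) \<in> borel_measurable ?M"
        by (rule borel_measurableI_less) (simp add: M grid_approximable_halfspace[OF S])
      show "x S \<in> {0..1}" if "x \<in> space ?M" for x using Xk_range[OF _ S] that M by blast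
    qed
  next
    fix x assume "x \<in> space ?M"
    then have "x \<in> space (Xk k)" by (simp only: M)
    then show "x \<in> extensional (rsets {1..k})" unfolding space_Xk by (simp add: PiE_iff)
  qed
  from measurable_sets[OF this assms] show ?thesis
    using M sets.sets_into_space[OF assms] by (simp add: Int_absorb2)
qed

text \<open>For fixed N, a grid set can be recovered from the finite set of indices of its
  cells.\<close>

lemma countable_grid_sets: "countable {G. \<exists>N>0. grid_set k N G}"
proof -
  have "countable {G. grid_set k N G}" if N: "N > 0" for N
  proof -
    let ?c = "\<lambda>x. \<lambda>S\<in>rsets {1..k}. \<lfloor>real N * x S\<rfloor>"
    have "inj_on (\<lambda>G. ?c ` G) {G. grid_set k N G}"
    proof -
      have sub: "G \<subseteq> H" if G: "grid_set k N G" and H: "grid_set k N H" and eq: "?c ` G = ?c ` H" for G H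
      proof
        fix x assume x: "x \<in> G"
        then have "?c x \<in> ?c ` H" using eq by blast
        then obtain y where y: "y \<in> H" "?c x = ?c y" by blast
        have "x \<in> space (Xk k)" using x grid_set_sets[OF G] sets.sets_into_space by blast
        with H y(1) show "x \<in> H"
        proof (rule grid_setD)
          fix S assume "S \<in> rsets {1..k}"
          then show "\<lfloor>real N * y S\<rfloor> = \<lfloor>real N * x S\<rfloor>" using fun_cong[OF y(2), of S] by simp
        qed
      qed
      show ?thesis by (rule inj_onI, rule equalityI) (simp_all add: sub)
    qed
    moreover have "(\<lambda>G. ?c ` G) ` {G. grid_set k N G} \<subseteq> Pow (\<Pi>\<^sub>E S\<in>rsets {1..k}. {0..int N})"
    proof (intro subsetI PowI; elim imageE)
      fix A G z assume "A = ?c ` G" "z \<in> A" "G \<in> {G. grid_set k N G}"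
      then obtain x where x: "x \<in> G" "z = ?c x" and G: "grid_set k N G" by auto
      then have "x \<in> space (Xk k)" using grid_set_sets[OF G] sets.sets_into_space by blast
      from Xk_range'[OF this] have "\<lfloor>real N * x S\<rfloor> \<in> {0..int N}" if "S \<in> rsets {1..k}" for S
        using that by (auto simp: floor_le_iff mult_left_le intro: le_less_trans[of _ "real N"])
      then show "z \<in> (\<Pi>\<^sub>E S\<in>rsets {1..k}. {0..int N})" using x by auto
    qed
    moreover have "finite (Pow (\<Pi>\<^sub>E S\<in>rsets {1..k}. {0..int N}))"
      by (intro finite_Pow_iff[THEN iffD2] finite_PiE) auto
    ultimately have "finite {G. grid_set k N G}" by (metis finite_imageD finite_subset)
    then show ?thesis by (rule countable_finite)
  qed
  then have "countable (\<Union>N\<in>{0<..}. {G. grid_set k N G})" by (intro countable_UN) auto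
  then show ?thesis by (rule back_subst[where P=countable]) auto
qed

section \<open>Quotients of pseudometric spaces and Borel selectors\<close>

lemma class_dist_eq:
  assumes R: "equiv M R"
    and resp: "\<And>x x' y y'. (x, x') \<in> R \<Longrightarrow> (y, y') \<in> R \<Longrightarrow> d x y = d x' y'"
    and PQ: "P \<in> M // R" "Q \<in> M // R" and xy: "x \<in> P" "y \<in> Q"
  shows "class_dist (M // R) d P Q = d x y"
proof -
  have "d u v = d x y" if "u \<in> P" "v \<in> Q" for u v
    using that xy PQ by (intro resp in_quotient_imp_in_rel[OF R]) auto
  then have "(\<lambda>(u, v). d u v) ` (P \<times> Q) = (\<lambda>_. d x y) ` (P \<times> Q)" by (intro image_cong) auto
  also have "\<dots> = {d x y}" using xy by (intro image_constant) auto
  finally have "(\<lambda>(u, v). d u v) ` (P \<times> Q) = {d x y}" .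
  then show ?thesis using PQ by (simp add: class_dist_def)
qed

text \<open>Three instances matter: \<open>d1\<close> and \<open>delta1\<close> on hypergraphons,
  and \<open>delta1_W0\<close> on \<open>W0\<close>. Both quotients in the main statement identify
  points at distance zero.\<close>

locale pseudometric =
  fixes M :: "'a set" and d :: "'a \<Rightarrow> 'a \<Rightarrow> real"
  assumes nonneg: "x \<in> M \<Longrightarrow> y \<in> M \<Longrightarrow> 0 \<le> d x y"
    and refl: "x \<in> M \<Longrightarrow> d x x = 0"
    and sym: "x \<in> M \<Longrightarrow> y \<in> M \<Longrightarrow> d x y = d y x"
    and triangle: "x \<in> M \<Longrightarrow> y \<in> M \<Longrightarrow> z \<in> M \<Longrightarrow> d x z \<le> d x y + d y z"
begin

definition zero_rel :: "('a \<times> 'a) set" where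
  "zero_rel = {(x, y). x \<in> M \<and> y \<in> M \<and> d x y = 0}"

lemma equiv_zero_rel: "equiv M zero_rel"
proof (rule equivI)
  show "trans zero_rel"
  proof (rule transI)
    fix x y z assume "(x, y) \<in> zero_rel" "(y, z) \<in> zero_rel"
    then show "(x, z) \<in> zero_rel"
      using triangle[of x y z] nonneg[of x z] by (auto simp: zero_rel_def)
  qed
qed (auto simp: zero_rel_def refl_on_def sym_def refl sym)

lemma dist_respects:
  assumes "(x, x') \<in> zero_rel" "(y, y') \<in> zero_rel"
  shows "d x y = d x' y'"
  using assms triangle[of x x' y] triangle[of x' y' y] triangle[of x' x y'] triangle[of x y y']
    sym[of x x'] sym[of y y'] by (auto simp: zero_rel_def)

lemma class_dist:
  assumes "P \<in> M // zero_rel" "Q \<in> M // zero_rel" "x \<in> P" "y \<in> Q"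
  shows "class_dist (M // zero_rel) d P Q = d x y"
  using equiv_zero_rel dist_respects assms by (rule class_dist_eq)

lemma class_elem:
  assumes "P \<in> M // zero_rel"
  obtains x where "x \<in> P" "x \<in> M"
proof -
  obtain x where "x \<in> P" using in_quotient_imp_non_empty[OF equiv_zero_rel assms] by auto
  moreover have "P \<subseteq> M" using in_quotient_imp_subset[OF equiv_zero_rel assms] .
  ultimately show ?thesis using that by auto
qed

lemma Metric_space_quotient: "Metric_space (M // zero_rel) (class_dist (M // zero_rel) d)"
proof
  fix P Q
  show "0 \<le> class_dist (M // zero_rel) d P Q"
  proof (cases "P \<in> M // zero_rel \<and> Q \<in> M // zero_rel")
    case True
    then obtain x y where "x \<in> P" "x \<in> M" "y \<in> Q" "y \<in> M" by (metis class_elem)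
    then show ?thesis using class_dist True nonneg by simp
  qed (simp only: class_dist_def if_False)
  show "class_dist (M // zero_rel) d P Q = class_dist (M // zero_rel) d Q P"
  proof (cases "P \<in> M // zero_rel \<and> Q \<in> M // zero_rel")
    case True
    then obtain x y where "x \<in> P" "x \<in> M" "y \<in> Q" "y \<in> M" by (metis class_elem)
    then show ?thesis using class_dist True sym by simp
  qed (auto simp: class_dist_def)
next
  fix P Q assume PQ: "P \<in> M // zero_rel" "Q \<in> M // zero_rel"
  then obtain x y where xy: "x \<in> P" "x \<in> M" "y \<in> Q" "y \<in> M" by (metis class_elem)
  have "P = Q \<longleftrightarrow> (x, y) \<in> zero_rel"
    using quotient_eq_iff[OF equiv_zero_rel PQ xy(1,3)] .
  then show "class_dist (M // zero_rel) d P Q = 0 \<longleftrightarrow> P = Q"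
    using class_dist[OF PQ xy(1,3)] xy by (auto simp: zero_rel_def)
next
  fix P Q S assume PQS: "P \<in> M // zero_rel" "Q \<in> M // zero_rel" "S \<in> M // zero_rel"
  then obtain x y z where "x \<in> P" "x \<in> M" "y \<in> Q" "y \<in> M" "z \<in> S" "z \<in> M" by (metis class_elem)
  then show "class_dist (M // zero_rel) d P S \<le> class_dist (M // zero_rel) d P Q + class_dist (M // zero_rel) d Q S"
    using class_dist PQS triangle by simp
qed

end

section \<open>Borel structures of metric spaces and the selector\<close>

lemma space_metric_borel: "Metric_space M d \<Longrightarrow> space (metric_borel M d) = M"
  by (simp add: metric_borel_def space_measure_of_conv)

lemma sets_metric_borel_open:
  assumes "Metric_space M d" "openin (Metric_space.mtopology M d) U"
  shows "U \<in> sets (metric_borel M d)"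
proof -
  have "{U. openin (Metric_space.mtopology M d) U} \<subseteq> Pow M"
    using openin_subset Metric_space.topspace_mtopology[OF assms(1)] by fastforce
  then show ?thesis using assms(2) by (simp add: metric_borel_def sets_measure_of)
qed

lemma measurable_metric_borelI:
  assumes "Metric_space M d" and "\<And>x. x \<in> space N \<Longrightarrow> f x \<in> M"
    and "\<And>U. openin (Metric_space.mtopology M d) U \<Longrightarrow> {x \<in> space N. f x \<in> U} \<in> sets N"
  shows "f \<in> measurable N (metric_borel M d)"
  unfolding metric_borel_def
proof (rule measurable_measure_of)
  show "{U. openin (Metric_space.mtopology M d) U} \<subseteq> Pow M"
    using openin_subset Metric_space.topspace_mtopology[OF assms(1)] by fastforce
  show "f -` U \<inter> space N \<in> sets N" if "U \<in> {U. openin (Metric_space.mtopology M d) U}" for U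
    using assms(3)[of U] that by (simp add: vimage_def Int_def conj_commute)
qed (use assms(2) in auto)

text \<open>Since the quotient map is open, the classes close to a given point form an open set. As in the
  Kuratowski--Ryll-Nardzewski theorem, the selector is the limit of maps into a countable dense set,
  each of them taking the first admissible index.\<close>

theorem borel_selector_quotient:
  assumes metric: "Metric_space M d" and pm: "pseudometric M \<delta>"
    and le: "\<And>x y. x \<in> M \<Longrightarrow> y \<in> M \<Longrightarrow> \<delta> x y \<le> d x y"
    and lift: "\<And>x y e. x \<in> M \<Longrightarrow> y \<in> M \<Longrightarrow> \<delta> x y < e \<Longrightarrow> \<exists>z\<in>M. \<delta> y z = 0 \<and> d x z < e"
    and D: "countable D" "D \<subseteq> M" "\<And>x e. x \<in> M \<Longrightarrow> 0 < e \<Longrightarrow> \<exists>w\<in>D. d w x < e"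
    and complete: "\<And>\<sigma>. range \<sigma> \<subseteq> M \<Longrightarrow> (\<And>n. d (\<sigma> n) (\<sigma> (Suc n)) < (1/2) ^ n) \<Longrightarrow>
      \<exists>l\<in>M. \<forall>n. d (\<sigma> n) l \<le> 2 * (1/2) ^ n"
    and ne: "M \<noteq> {}"
  defines "Q \<equiv> M // {(x, y). x \<in> M \<and> y \<in> M \<and> \<delta> x y = 0}"
  shows "\<exists>S \<in> measurable (metric_borel Q (class_dist Q \<delta>)) (metric_borel M d). \<forall>C\<in>Q. S C \<in> C"
proof -
  interpret Metric_space M d by (rule metric)
  interpret P: pseudometric M \<delta> by (rule pm)
  have Q: "Q = M // P.zero_rel" by (simp add: Q_def P.zero_rel_def)
  interpret Q: Metric_space Q "class_dist Q \<delta>" unfolding Q by (rule P.Metric_space_quotient)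
  let ?B = "metric_borel Q (class_dist Q \<delta>)"
  have spB: "space ?B = Q" by (rule space_metric_borel) unfold_locales
  have "D \<noteq> {}" using ne D(3)[of _ 1] by fastforce
  define w where "w = from_nat_into D"
  have w: "w i \<in> M" for i using from_nat_into[OF \<open>D \<noteq> {}\<close>] D(2) by (auto simp: w_def)
  have w_dense: "\<exists>i. d (w i) x < e" if "x \<in> M" "0 < e" for x e
    using D(3)[OF that] range_from_nat_into[OF \<open>D \<noteq> {}\<close> D(1)] by (metis w_def rangeE)
  \<comment> \<open>An arbitrary representative, chosen without regard to measurability.
    Measurability arguments meet it only through \<open>\<delta> x (rep C)\<close>, which is a
    distance in the quotient.\<close>
  define rep where "rep C = (SOME c. c \<in> C)" for C :: "'a set"
  have rep: "rep C \<in> C" "rep C \<in> M" if "C \<in> Q" for C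
  proof -
    show "rep C \<in> C" using P.class_elem[of C] that unfolding Q rep_def by (metis someI)
    then show "rep C \<in> M" using in_quotient_imp_subset[OF P.equiv_zero_rel] that Q by auto
  qed
  have rep_dist: "class_dist Q \<delta> (P.zero_rel `` {x}) C = \<delta> x (rep C)" "P.zero_rel `` {x} \<in> Q"
    if "x \<in> M" "C \<in> Q" for x C
  proof -
    show "P.zero_rel `` {x} \<in> Q" using that by (simp add: Q quotientI)
    moreover have "x \<in> P.zero_rel `` {x}" using that by (simp add: P.zero_rel_def P.refl)
    ultimately show "class_dist Q \<delta> (P.zero_rel `` {x}) C = \<delta> x (rep C)"
      using P.class_dist rep that unfolding Q by blast
  qed
  have near_meas: "Measurable.pred ?B (\<lambda>C. \<delta> x (rep C) < e)" if x: "x \<in> M" for x e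
  proof -
    have "{C \<in> space ?B. \<delta> x (rep C) < e} = Q.mball (P.zero_rel `` {x}) e"
      using rep_dist[OF x] by (auto simp: spB)
    then have "{C \<in> space ?B. \<delta> x (rep C) < e} \<in> sets ?B"
      using sets_metric_borel_open[OF Q.Metric_space_axioms Q.openin_mball] by simp
    then show ?thesis by (simp add: pred_def)
  qed

  \<comment> \<open>A least index is measurable when each of the countably many conditions is.
    Approximation \<open>n\<close> lies within \<open>(1/2) ^ (n + 1)\<close> of the class; a lift
    into the class costs at most that much and the return to the dense set
    \<open>(1/2) ^ (n + 2)\<close>, together less than the permitted step
    \<open>(1/2) ^ n\<close>.\<close>
  define idx where "idx C = rec_nat (LEAST i. \<delta> (w i) (rep C) < 1/2)
    (\<lambda>n j. LEAST i. \<delta> (w i) (rep C) < (1/2) ^ (n + 2) \<and> d (w j) (w i) < (1/2) ^ n)" for C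
  have idx_0: "idx C 0 = (LEAST i. \<delta> (w i) (rep C) < 1/2)" for C by (simp add: idx_def)
  have idx_Suc: "idx C (Suc n) = (LEAST i. \<delta> (w i) (rep C) < (1/2) ^ (n + 2) \<and> d (w (idx C n)) (w i) < (1/2) ^ n)"
    for C n by (simp add: idx_def)
  have idx_meas: "(\<lambda>C. idx C n) \<in> measurable ?B (count_space UNIV)" for n
  proof (induction n)
    case 0
    then show ?case unfolding idx_0 by (intro measurable_Least near_meas w)
  next
    case (Suc n)
    have "Measurable.pred ?B (\<lambda>C. d (w (idx C n)) (w i) < (1/2) ^ n)" for i
      by (rule measurable_compose[OF Suc]) simp
    then show ?case unfolding idx_Suc
      by (intro measurable_Least pred_intros_logic near_meas w)
  qed
  have step: "\<delta> (w (idx C (Suc n))) (rep C) < (1/2) ^ (n + 2) \<and> d (w (idx C n)) (w (idx C (Suc n))) < (1/2) ^ n"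
    if C: "C \<in> Q" and prev: "\<delta> (w (idx C n)) (rep C) < (1/2) ^ (n + 1)" for C n
  proof -
    \<comment> \<open>Openness of the quotient map enters here: the class itself has a point near
      the current approximation.\<close>
    obtain z where z: "z \<in> M" "\<delta> (rep C) z = 0" "d (w (idx C n)) z < (1/2) ^ (n + 1)"
      using lift[OF w rep(2)[OF C] prev] by auto
    obtain i where i: "d (w i) z < (1/2) ^ (n + 2)" using w_dense[OF z(1), of "(1/2) ^ (n + 2)"] by auto
    have "\<delta> (w i) (rep C) \<le> \<delta> (w i) z + \<delta> z (rep C)" by (intro P.triangle w z rep C)
    also have "\<delta> z (rep C) = 0" using z P.sym[of z "rep C"] rep[OF C] by simp
    finally have 1: "\<delta> (w i) (rep C) < (1/2) ^ (n + 2)" using le[OF w z(1), of i] i by simp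
    have "d (w (idx C n)) (w i) \<le> d (w (idx C n)) z + d z (w i)" by (intro triangle w z)
    also have "\<dots> < (1/2) ^ (n + 1) + (1/2) ^ (n + 2)" using z(3) i commute[of z "w i"] by simp
    also have "\<dots> \<le> (1/2) ^ n" by simp
    finally have "d (w (idx C n)) (w i) < (1/2) ^ n" .
    with 1 show ?thesis unfolding idx_Suc
      by (intro LeastI[where P="\<lambda>i. \<delta> (w i) (rep C) < (1/2) ^ (n + 2) \<and> d (w (idx C n)) (w i) < (1/2) ^ n"]) (rule conjI)
  qed
  have near: "\<delta> (w (idx C n)) (rep C) < (1/2) ^ (n + 1)" if C: "C \<in> Q" for C n
  proof (induction n)
    case 0
    obtain i where i: "d (w i) (rep C) < 1/2" using w_dense[OF rep(2)[OF C], of "1/2"] by auto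
    then have "\<delta> (w i) (rep C) < 1/2" using le[OF w rep(2)[OF C], of i] by simp
    then have "\<delta> (w (idx C 0)) (rep C) < 1/2"
      unfolding idx_0 by (rule LeastI[where P="\<lambda>i. \<delta> (w i) (rep C) < 1/2"])
    then show ?case by simp
  next
    case (Suc n)
    from step[OF C this] show ?case by simp
  qed
  define S where "S C = (SOME l. l \<in> M \<and> (\<forall>n. d (w (idx C n)) l \<le> 2 * (1/2) ^ n))" for C
  have S: "S C \<in> M" "d (w (idx C n)) (S C) \<le> 2 * (1/2) ^ n" if C: "C \<in> Q" for C n
  proof -
    have "\<exists>l\<in>M. \<forall>n. d (w (idx C n)) l \<le> 2 * (1/2) ^ n"
      using step[OF C near[OF C]] w by (intro complete) auto
    then have "\<exists>l. l \<in> M \<and> (\<forall>n. d (w (idx C n)) l \<le> 2 * (1/2) ^ n)" by blast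
    then have "S C \<in> M \<and> (\<forall>n. d (w (idx C n)) (S C) \<le> 2 * (1/2) ^ n)"
      unfolding S_def by (rule someI_ex)
    then show "S C \<in> M" "d (w (idx C n)) (S C) \<le> 2 * (1/2) ^ n" by auto
  qed
  have S_in: "S C \<in> C" if C: "C \<in> Q" for C
  proof -
    have "\<delta> (rep C) (S C) \<le> 3 * (1/2) ^ n" for n
    proof -
      have "\<delta> (rep C) (S C) \<le> \<delta> (rep C) (w (idx C n)) + \<delta> (w (idx C n)) (S C)"
        using rep(2)[OF C] w S(1)[OF C] by (rule P.triangle)
      also have "\<dots> \<le> (1/2) ^ (n + 1) + 2 * (1/2) ^ n"
        using near[OF C, of n] P.sym[OF w rep(2)[OF C], of "idx C n"]
        by (intro add_mono order_trans[OF le[OF w S(1)[OF C]] S(2)[OF C]]) simp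
      also have "\<dots> \<le> 3 * (1/2) ^ n" by simp
      finally show ?thesis .
    qed
    moreover have "(\<lambda>n. 3 * (1/2) ^ n :: real) \<longlonglongrightarrow> 0"
      by (intro tendsto_mult_right_zero LIMSEQ_power_zero) simp
    ultimately have "\<delta> (rep C) (S C) \<le> 0" by (intro LIMSEQ_le_const[where X="\<lambda>n. 3 * (1/2) ^ n"]) auto
    then have "(rep C, S C) \<in> P.zero_rel"
      using P.nonneg[OF rep(2)[OF C] S(1)[OF C]] rep[OF C] S(1)[OF C] by (simp add: P.zero_rel_def)
    then show ?thesis using in_quotient_imp_closed[OF P.equiv_zero_rel] C rep(1)[OF C] Q by blast
  qed
  have "S \<in> measurable ?B (metric_borel M d)"
  proof (rule measurable_metric_borelI)
    show "Metric_space M d" by (rule metric)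
    show "S C \<in> M" if "C \<in> space ?B" for C using S(1) that spB by simp
    fix U assume "openin mtopology U"
    then have U: "U \<subseteq> M" "\<And>x. x \<in> U \<Longrightarrow> \<exists>r>0. mball x r \<subseteq> U" by (auto simp: openin_mtopology)
    \<comment> \<open>\<open>U\<close> is asked to contain a whole closed ball about an
      approximation, with the error bound of that approximation as radius. This is a condition on
      the index alone, hence measurable, although \<open>S\<close> involves a choice of
      limit.\<close>
    let ?G = "\<lambda>n i. \<forall>x\<in>M. d (w i) x \<le> 2 * (1/2) ^ n \<longrightarrow> x \<in> U"
    have "S C \<in> U \<longleftrightarrow> (\<exists>n. ?G n (idx C n))" if C: "C \<in> Q" for C
    proof
      assume "S C \<in> U"
      then obtain r where r: "r > 0" "mball (S C) r \<subseteq> U" using U by blast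
      \<comment> \<open>Two points of such a ball are at distance at most
        \<open>4 * (1/2) ^ n\<close>, whence the quarter of \<open>r\<close>.\<close>
      obtain n where n: "(1/2) ^ n < r / 4" using real_arch_pow_inv[of "r / 4" "1/2"] r by auto
      have "?G n (idx C n)"
      proof (intro ballI impI)
        fix x assume x: "x \<in> M" "d (w (idx C n)) x \<le> 2 * (1/2) ^ n"
        have "d (S C) x \<le> d (S C) (w (idx C n)) + d (w (idx C n)) x" using S(1)[OF C] w x(1) by (rule triangle)
        also have "\<dots> \<le> 2 * (1/2) ^ n + 2 * (1/2) ^ n"
          using x(2) S(2)[OF C, of n] commute[of "S C" "w (idx C n)"] by (intro add_mono) simp_all
        also have "\<dots> < r" using n by simp
        finally have "x \<in> mball (S C) r" using x S(1)[OF C] by simp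
        then show "x \<in> U" using r by blast
      qed
      then show "\<exists>n. ?G n (idx C n)" by blast
    next
      assume "\<exists>n. ?G n (idx C n)"
      then show "S C \<in> U" using S[OF C] by blast
    qed
    then have "{C \<in> space ?B. S C \<in> U} = {C \<in> space ?B. \<exists>n. ?G n (idx C n)}" using spB by auto
    moreover have "Measurable.pred ?B (\<lambda>C. \<exists>n. ?G n (idx C n))"
    proof (rule pred_intros_countable(2))
      fix n
      show "Measurable.pred ?B (\<lambda>C. ?G n (idx C n))"
        by (rule measurable_compose[OF idx_meas[of n], of "?G n"]) simp
    qed
    ultimately show "{C \<in> space ?B. S C \<in> U} \<in> sets ?B" by (simp add: pred_def)
  qed
  then show ?thesis using S_in by blast
qed

section \<open>Hypergraphons\<close>

lemma perm_map_inverse: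
  assumes "\<sigma> permutes {1..k}" "x \<in> space (Xk k)"
  shows "perm_map k \<sigma> (perm_map k (inv \<sigma>) x) = x"
proof
  fix S
  show "perm_map k \<sigma> (perm_map k (inv \<sigma>) x) S = x S"
  proof (cases "S \<in> rsets {1..k}")
    case True
    have "inv \<sigma> ` \<sigma> ` S = S" using permutes_inj[OF assms(1)] by (simp add: image_image)
    then show ?thesis using True perm_image_rsets[OF assms(1) True] by (simp add: perm_map_def)
  next
    case False
    then show ?thesis using assms(2) by (simp add: perm_map_def space_Xk PiE_iff extensional_def)
  qed
qed

text \<open>One inclusion for every permutation is enough, since the inverse permutation supplies
  the other.\<close>

lemma hypergraphonI:
  assumes "W \<in> sets (Xk k)"
    and "\<And>\<sigma> x. \<sigma> permutes {1..k} \<Longrightarrow> x \<in> W \<Longrightarrow> perm_map k \<sigma> x \<in> W"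
  shows "hypergraphon k W"
  unfolding hypergraphon_def
proof (intro conjI allI impI assms(1))
  fix \<sigma> assume \<sigma>: "\<sigma> permutes {1..k}"
  show "perm_map k \<sigma> ` W = W"
  proof
    show "perm_map k \<sigma> ` W \<subseteq> W" using assms(2)[OF \<sigma>] by auto
    show "W \<subseteq> perm_map k \<sigma> ` W"
    proof
      fix x assume x: "x \<in> W"
      have "x = perm_map k \<sigma> (perm_map k (inv \<sigma>) x)"
        using perm_map_inverse[OF \<sigma>] x sets.sets_into_space[OF assms(1)] by auto
      moreover have "perm_map k (inv \<sigma>) x \<in> W" using assms(2)[OF permutes_inv[OF \<sigma>] x] .
      ultimately show "x \<in> perm_map k \<sigma> ` W" by blast
    qed
  qed
qed

lemma hypergraphon_sets: "hypergraphon k W \<Longrightarrow> W \<in> sets (Xk k)"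
  by (simp add: hypergraphon_def)

lemma hypergraphon_perm_map:
  "hypergraphon k W \<Longrightarrow> \<sigma> permutes {1..k} \<Longrightarrow> x \<in> W \<Longrightarrow> perm_map k \<sigma> x \<in> W"
  unfolding hypergraphon_def by blast

lemma hypergraphon_pullback:
  assumes W: "hypergraphon k W" and \<psi>: "structure_preserving k \<psi>"
  shows "hypergraphon k (pullback k \<psi> W)"
proof (rule hypergraphonI)
  show "pullback k \<psi> W \<in> sets (Xk k)"
    using structure_preserving_measurable[OF \<psi>] hypergraphon_sets[OF W] by (rule pullback_sets)
  fix \<sigma> x assume \<sigma>: "\<sigma> permutes {1..k}" and "x \<in> pullback k \<psi> W"
  then show "perm_map k \<sigma> x \<in> pullback k \<psi> W"
    using hypergraphon_perm_map[OF W \<sigma>] structure_preserving_perm_map[OF \<psi> \<sigma>] perm_map_space[OF \<sigma>]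
    by (auto simp: pullback_def)
qed

lemma pullback_pullback:
  assumes "structure_preserving k \<rho>"
  shows "pullback k \<rho> (pullback k \<psi> W) = pullback k (\<lambda>x. \<psi> (\<rho> x)) W"
  using measurable_space[OF structure_preserving_measurable[OF assms]] by (auto simp: pullback_def)

lemma d1_pullback:
  assumes \<psi>: "structure_preserving k \<psi>" and "U \<in> sets (Xk k)" "W \<in> sets (Xk k)"
  shows "d1 k (pullback k \<psi> U) (pullback k \<psi> W) = d1 k U W"
proof -
  have "sym_diff (pullback k \<psi> U) (pullback k \<psi> W) = pullback k \<psi> (sym_diff U W)"
    by (auto simp: pullback_def)
  moreover have "emeasure (Xk k) (pullback k \<psi> (sym_diff U W)) = emeasure (Xk k) (sym_diff U W)"
    using assms unfolding structure_preserving_def by blast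
  ultimately show ?thesis by (simp only: d1_def measure_def)
qed

text \<open>The order of choices matters: first the mesh, from \<open>W\<close> and
  \<open>e\<close>, then \<open>\<rho>\<close> for this mesh. The grid set is invariant under the
  composition up to a null set, and the error of the grid approximation occurs twice, before and
  after pulling back, each time below \<open>e / 2\<close>.\<close>

lemma almost_invariant_pullback:
  assumes \<psi>: "structure_preserving k \<psi>" and W: "W \<in> sets (Xk k)" and e: "0 < e"
  obtains \<rho> where "structure_preserving k \<rho>" "d1 k (pullback k (\<lambda>x. \<psi> (\<rho> x)) W) W < e"
proof -
  obtain N G where N: "N > 0" and G: "grid_set k N G" and WG: "d1 k W G < e / 2"
    using grid_approximableE[OF grid_approximable[OF W], of "e / 2"] e by auto
  obtain \<rho> where \<rho>: "structure_preserving k \<rho>"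
    and AE: "AE x in Xk k. \<forall>S\<in>rsets {1..k}. \<lfloor>real N * \<psi> (\<rho> x) S\<rfloor> = \<lfloor>real N * x S\<rfloor>"
    using approximate_right_inverse[OF N \<psi>] by blast
  let ?\<chi> = "\<lambda>x. \<psi> (\<rho> x)"
  have \<chi>: "structure_preserving k ?\<chi>" using structure_preserving_compose[OF \<rho> \<psi>] .
  note m = structure_preserving_measurable[OF \<chi>] and Gs = grid_set_sets[OF G]
  note pW = pullback_sets[OF m W] and pG = pullback_sets[OF m Gs]
  have "AE x in Xk k. x \<notin> sym_diff (pullback k ?\<chi> G) G"
    using AE AE_space
  proof eventually_elim
    case (elim x)
    have \<chi>x: "?\<chi> x \<in> space (Xk k)" using measurable_space[OF m elim(2)] .
    have "x \<in> G \<longleftrightarrow> ?\<chi> x \<in> G"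
      using grid_setD[OF G _ \<chi>x, of x] grid_setD[OF G _ elim(2), of "?\<chi> x"] elim(1) by auto
    then show ?case using elim(2) by (auto simp: pullback_def)
  qed
  then have "d1 k (pullback k ?\<chi> G) G = 0"
    unfolding d1_def using pG Gs by (subst Xk.prob_eq_0) auto
  moreover have "d1 k (pullback k ?\<chi> W) (pullback k ?\<chi> G) < e / 2"
    using d1_pullback[OF \<chi> W Gs] WG by simp
  moreover have "d1 k (pullback k ?\<chi> W) W \<le> d1 k (pullback k ?\<chi> W) (pullback k ?\<chi> G) + d1 k (pullback k ?\<chi> G) W"
    by (rule d1_triangle[OF pW pG W])
  moreover have "d1 k (pullback k ?\<chi> G) W \<le> d1 k (pullback k ?\<chi> G) G + d1 k G W"
    by (rule d1_triangle[OF pG Gs W])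
  ultimately have "d1 k (pullback k ?\<chi> W) W < e" using WG d1_commute[of k G W] by linarith
  with \<rho> show ?thesis by (rule that)
qed

section \<open>The distance \<open>delta1\<close> and its one-sided form\<close>

lemma delta1_le:
  assumes "structure_preserving k \<phi>" "structure_preserving k \<psi>"
  shows "delta1 k U W \<le> d1 k (pullback k \<phi> U) (pullback k \<psi> W)"
  unfolding delta1_def using assms d1_nonneg by (intro cInf_lower bdd_belowI[of _ 0]) auto

lemma delta1_nonneg: "0 \<le> delta1 k U W"
  unfolding delta1_def using structure_preserving_id d1_nonneg by (intro cInf_greatest) auto

lemma delta1_commute: "delta1 k U W = delta1 k W U"
proof -
  have "{d1 k (pullback k \<phi> U) (pullback k \<psi> W) | \<phi> \<psi>. structure_preserving k \<phi> \<and> structure_preserving k \<psi>}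
    = {d1 k (pullback k \<phi> W) (pullback k \<psi> U) | \<phi> \<psi>. structure_preserving k \<phi> \<and> structure_preserving k \<psi>}"
    using d1_commute by metis
  then show ?thesis by (simp only: delta1_def)
qed

lemma pullback_id: "W \<in> sets (Xk k) \<Longrightarrow> pullback k (\<lambda>x. x) W = W"
  unfolding pullback_def by (drule sets.sets_into_space) auto

lemma delta1_le_d1: "U \<in> sets (Xk k) \<Longrightarrow> W \<in> sets (Xk k) \<Longrightarrow> delta1 k U W \<le> d1 k U W"
  using delta1_le[OF structure_preserving_id structure_preserving_id, of k U W] by (simp add: pullback_id)

text \<open>Pulled back along \<open>\<psi>\<close> and along the identity respectively, the two
  sets coincide.\<close>

lemma delta1_pullback:
  assumes W: "W \<in> sets (Xk k)" and \<psi>: "structure_preserving k \<psi>"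
  shows "delta1 k W (pullback k \<psi> W) = 0"
  using delta1_le[OF \<psi> structure_preserving_id, of W "pullback k \<psi> W"] delta1_nonneg[of k W "pullback k \<psi> W"]
    pullback_id[OF pullback_sets[OF structure_preserving_measurable[OF \<psi>] W]] by simp

text \<open>A single pullback suffices in the definition of \<open>\<delta>\<^sub>1\<close>, so that the quotient map by \<open>\<delta>\<^sub>1\<close> is open.\<close>

lemma delta1_lessE:
  assumes U: "U \<in> sets (Xk k)" and W: "W \<in> sets (Xk k)" and less: "delta1 k U W < e"
  obtains \<psi> where "structure_preserving k \<psi>" "d1 k U (pullback k \<psi> W) < e"
proof -
  have "{d1 k (pullback k \<phi> U) (pullback k \<psi> W) | \<phi> \<psi>.
      structure_preserving k \<phi> \<and> structure_preserving k \<psi>} \<noteq> {}"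
    using structure_preserving_id by blast
  from cInf_lessD[OF this less[unfolded delta1_def]]
  obtain \<phi> \<psi> where \<phi>: "structure_preserving k \<phi>" and \<psi>: "structure_preserving k \<psi>"
    and l: "d1 k (pullback k \<phi> U) (pullback k \<psi> W) < e" by auto
  \<comment> \<open>\<open>\<rho>\<close> nearly inverts \<open>\<phi>\<close> as far as
    \<open>U\<close> is concerned, within the slack left by \<open>e\<close>. Pulling both sets back
    along \<open>\<rho>\<close> keeps their distance, and then \<open>U\<close> can replace its own
    pullback.\<close>
  obtain \<rho> where \<rho>: "structure_preserving k \<rho>"
    and r: "d1 k (pullback k (\<lambda>x. \<phi> (\<rho> x)) U) U < e - d1 k (pullback k \<phi> U) (pullback k \<psi> W)"
    using almost_invariant_pullback[OF \<phi> U, of "e - d1 k (pullback k \<phi> U) (pullback k \<psi> W)"] l by auto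
  note \<phi>\<rho> = structure_preserving_compose[OF \<rho> \<phi>] and \<psi>\<rho> = structure_preserving_compose[OF \<rho> \<psi>]
  note s = pullback_sets[OF structure_preserving_measurable]
  have "d1 k (pullback k (\<lambda>x. \<phi> (\<rho> x)) U) (pullback k (\<lambda>x. \<psi> (\<rho> x)) W) = d1 k (pullback k \<phi> U) (pullback k \<psi> W)"
    using d1_pullback[OF \<rho> s[OF \<phi> U] s[OF \<psi> W]] by (simp add: pullback_pullback[OF \<rho>])
  moreover have "d1 k U (pullback k (\<lambda>x. \<psi> (\<rho> x)) W)
    \<le> d1 k U (pullback k (\<lambda>x. \<phi> (\<rho> x)) U) + d1 k (pullback k (\<lambda>x. \<phi> (\<rho> x)) U) (pullback k (\<lambda>x. \<psi> (\<rho> x)) W)"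
    by (rule d1_triangle[OF U s[OF \<phi>\<rho> U] s[OF \<psi>\<rho> W]])
  ultimately have "d1 k U (pullback k (\<lambda>x. \<psi> (\<rho> x)) W) < e" using r d1_commute[of k U] by simp
  with \<psi>\<rho> show ?thesis by (rule that)
qed

text \<open>By the definition alone, \<open>V\<close> would enter the two distances through
  different pullbacks, with no common set to compare to. In the one-sided form both distances are
  measured from \<open>V\<close> itself.\<close>

lemma delta1_triangle:
  assumes U: "U \<in> sets (Xk k)" and V: "V \<in> sets (Xk k)" and W: "W \<in> sets (Xk k)"
  shows "delta1 k U W \<le> delta1 k U V + delta1 k V W"
proof (rule field_le_epsilon)
  fix e :: real assume "0 < e"
  obtain \<phi> where \<phi>: "structure_preserving k \<phi>" "d1 k V (pullback k \<phi> U) < delta1 k U V + e / 2"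
    using delta1_lessE[OF V U, of "delta1 k U V + e / 2"] \<open>0 < e\<close> delta1_commute[of k U V] by auto
  obtain \<psi> where \<psi>: "structure_preserving k \<psi>" "d1 k V (pullback k \<psi> W) < delta1 k V W + e / 2"
    using delta1_lessE[OF V W, of "delta1 k V W + e / 2"] \<open>0 < e\<close> by auto
  note s = pullback_sets[OF structure_preserving_measurable]
  have "delta1 k U W \<le> d1 k (pullback k \<phi> U) (pullback k \<psi> W)" by (rule delta1_le[OF \<phi>(1) \<psi>(1)])
  also have "\<dots> \<le> d1 k (pullback k \<phi> U) V + d1 k V (pullback k \<psi> W)"
    by (rule d1_triangle[OF s[OF \<phi>(1) U] V s[OF \<psi>(1) W]])
  finally show "delta1 k U W \<le> delta1 k U V + delta1 k V W + e"
    using \<phi>(2) \<psi>(2) d1_commute[of k "pullback k \<phi> U" V] by simp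
qed

text \<open>The limit is the upper limit of the sets, so it is exactly invariant under permutations.
  A point in none of the successive differences from \<open>n\<close> on never changes membership,
  which bounds the distance by a geometric tail.\<close>

lemma hypergraphon_limit:
  assumes W: "\<And>n. hypergraphon k (W n)" and d: "\<And>n. d1 k (W n) (W (Suc n)) < (1/2) ^ n"
  obtains L where "hypergraphon k L" "\<And>n. d1 k (W n) L \<le> 2 * (1/2) ^ n"
proof
  let ?L = "\<Inter>m. \<Union>i. W (m + i)"
  note Ws = hypergraphon_sets[OF W]
  have Ls: "?L \<in> sets (Xk k)" using Ws by (intro sets.countable_INT sets.countable_UN) auto
  show "hypergraphon k ?L"
  proof (rule hypergraphonI[OF Ls])
    fix \<sigma> x assume \<sigma>: "\<sigma> permutes {1..k}" and x: "x \<in> ?L"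
    show "perm_map k \<sigma> x \<in> ?L"
    proof
      fix m
      obtain i where "x \<in> W (m + i)" using x by auto
      then show "perm_map k \<sigma> x \<in> (\<Union>i. W (m + i))" using hypergraphon_perm_map[OF W \<sigma>] by blast
    qed
  qed
  fix n
  let ?D = "\<lambda>i. sym_diff (W (n + i)) (W (Suc (n + i)))"
  have Ds: "?D i \<in> sets (Xk k)" for i using Ws by auto
  have le: "Xk.prob k (?D i) \<le> (1/2) ^ n * (1/2) ^ i" for i
    using d[of "n + i"] by (simp add: d1_def power_add)
  have sum: "summable (\<lambda>i. (1/2) ^ n * (1/2) ^ i :: real)" by (intro summable_mult summable_geometric) simp
  have "sym_diff (W n) ?L \<subseteq> (\<Union>i. ?D i)"
  proof
    fix x assume x: "x \<in> sym_diff (W n) ?L"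
    show "x \<in> (\<Union>i. ?D i)"
    proof (rule ccontr)
      assume "x \<notin> (\<Union>i. ?D i)"
      then have "x \<in> W (n + i) \<longleftrightarrow> x \<in> W (n + Suc i)" for i by auto
      then have const: "x \<in> W (n + i) \<longleftrightarrow> x \<in> W n" for i by (induction i) auto
      have "x \<in> ?L \<longleftrightarrow> x \<in> W n"
      proof
        assume "x \<in> ?L"
        then obtain i where "x \<in> W (n + i)" by auto
        then show "x \<in> W n" using const by blast
      next
        assume x: "x \<in> W n"
        show "x \<in> ?L"
        proof
          fix m show "x \<in> (\<Union>i. W (m + i))" using const[of m] x by (auto simp: add.commute intro!: exI[of _ n])
        qed
      qed
      then show False using x by auto
    qed
  qed
  then have "d1 k (W n) ?L \<le> Xk.prob k (\<Union>i. ?D i)"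
    by (rule d1_mono[OF Ws Ls sets.countable_UN, rotated]) (use Ds in auto)
  also have "\<dots> \<le> (\<Sum>i. Xk.prob k (?D i))"
    using Ds le by (intro Xk.finite_measure_subadditive_countably summable_comparison_test'[OF sum]) auto
  also have "\<dots> \<le> (\<Sum>i. (1/2) ^ n * (1/2) ^ i)"
    using le sum by (intro suminf_le summable_comparison_test'[OF sum]) auto
  also have "\<dots> = 2 * (1/2) ^ n" using suminf_mult[of "\<lambda>i. (1/2) ^ i :: real" "(1/2) ^ n"] by (simp add: suminf_geometric)
  finally show "d1 k (W n) ?L \<le> 2 * (1/2) ^ n" .
qed

text \<open>A grid set close to a hypergraphon need not be symmetric. Therefore one hypergraphon is
  picked near each grid set for each precision at which there is one, and two errors below
  \<open>e / 2\<close> add up.\<close>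

lemma hypergraphon_separable:
  obtains D where "countable D" "\<And>W. W \<in> D \<Longrightarrow> hypergraphon k W"
    "\<And>W e. hypergraphon k W \<Longrightarrow> 0 < e \<Longrightarrow> \<exists>V\<in>D. d1 k V W < e"
proof
  let ?\<G> = "{G. \<exists>N>0. grid_set k N G}"
  let ?near = "\<lambda>G n V. hypergraphon k V \<and> d1 k V G < 1 / real (Suc n)"
  let ?I = "{(G, n). G \<in> ?\<G> \<and> (\<exists>V. ?near G n V)}"
  let ?D = "(\<lambda>(G, n). SOME V. ?near G n V) ` ?I"
  have "?I \<subseteq> ?\<G> \<times> (UNIV :: nat set)" by auto
  then have "countable ?I"
    by (rule countable_subset) (intro countable_SIGMA countable_grid_sets countableI_type)
  then show "countable ?D" by (rule countable_image)
  show "hypergraphon k W" if "W \<in> ?D" for W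
  proof -
    from that obtain G n where "\<exists>V. ?near G n V" and W: "W = (SOME V. ?near G n V)" by auto
    from someI_ex[OF this(1)] show ?thesis unfolding W by blast
  qed
  fix W and e :: real assume W: "hypergraphon k W" and e: "0 < e"
  note Ws = hypergraphon_sets[OF W]
  obtain n where n: "1 / real (Suc n) < e / 2" using nat_approx_posE[of "e / 2"] e by auto
  obtain N G where G: "N > 0" "grid_set k N G" "d1 k W G < 1 / real (Suc n)"
    using grid_approximableE[OF grid_approximable[OF Ws], of "1 / real (Suc n)"] by auto
  let ?V = "SOME V. ?near G n V"
  have ex: "\<exists>V. ?near G n V" using W G by blast
  then have V: "?near G n ?V" by (rule someI_ex)
  have "(G, n) \<in> ?I" using ex G by blast
  then have "?V \<in> ?D" by (rule rev_image_eqI) simp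
  moreover have "d1 k ?V W \<le> d1 k ?V G + d1 k G W"
    using V hypergraphon_sets grid_set_sets[OF G(2)] Ws by (intro d1_triangle) auto
  then have "d1 k ?V W < e" using V G(3) n d1_commute[of k G W] by linarith
  ultimately show "\<exists>V\<in>?D. d1 k V W < e" by (rule rev_bexI)
qed

section \<open>The two quotient spaces and the selection theorem\<close>

lemma pseudometric_d1: "pseudometric {W. hypergraphon k W} (d1 k)"
proof
  fix U V W assume "U \<in> {W. hypergraphon k W}" "V \<in> {W. hypergraphon k W}" "W \<in> {W. hypergraphon k W}"
  then have s: "U \<in> sets (Xk k)" "V \<in> sets (Xk k)" "W \<in> sets (Xk k)" by (auto dest: hypergraphon_sets)
  show "d1 k U U = 0" by (rule d1_refl)
  show "0 \<le> d1 k U V" by (rule d1_nonneg)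
  show "d1 k U V = d1 k V U" by (rule d1_commute)
  show "d1 k U W \<le> d1 k U V + d1 k V W" by (rule d1_triangle[OF s])
qed

lemma pseudometric_delta1: "pseudometric {W. hypergraphon k W} (delta1 k)"
proof
  fix U V W assume "U \<in> {W. hypergraphon k W}" "V \<in> {W. hypergraphon k W}" "W \<in> {W. hypergraphon k W}"
  then have s: "U \<in> sets (Xk k)" "V \<in> sets (Xk k)" "W \<in> sets (Xk k)" by (auto dest: hypergraphon_sets)
  show "delta1 k U U = 0" using delta1_le_d1[OF s(1,1)] delta1_nonneg[of k U U] by simp
  show "0 \<le> delta1 k U V" by (rule delta1_nonneg)
  show "delta1 k U V = delta1 k V U" by (rule delta1_commute)
  show "delta1 k U W \<le> delta1 k U V + delta1 k V W" by (rule delta1_triangle[OF s])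
qed

interpretation d1: pseudometric "{W. hypergraphon k W}" "d1 k" for k
  by (rule pseudometric_d1)

lemma W0_eq: "W0 k = {W. hypergraphon k W} // d1.zero_rel k"
proof -
  have "{(U, W). hypergraphon k U \<and> hypergraphon k W \<and> emeasure (Xk k) (sym_diff U W) = 0} = d1.zero_rel k"
    by (auto simp: d1.zero_rel_def d1_def Xk.emeasure_eq_measure)
  then show ?thesis by (simp only: W0_def)
qed

lemma W0_elem:
  assumes "P \<in> W0 k"
  obtains W where "W \<in> P" "hypergraphon k W"
  using d1.class_elem[of P k] assms unfolding W0_eq by blast

lemma W0_class:
  assumes "hypergraphon k W"
  shows "d1.zero_rel k `` {W} \<in> W0 k" "W \<in> d1.zero_rel k `` {W}"
  using assms quotientI[of W "{W. hypergraphon k W}" "d1.zero_rel k"] unfolding W0_eq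
  by (auto simp: d1.zero_rel_def)

lemma W0_hypergraphon: "P \<in> W0 k \<Longrightarrow> W \<in> P \<Longrightarrow> hypergraphon k W"
  using in_quotient_imp_subset[OF d1.equiv_zero_rel] unfolding W0_eq by blast

lemma dist_W0_eq:
  "P \<in> W0 k \<Longrightarrow> Q \<in> W0 k \<Longrightarrow> U \<in> P \<Longrightarrow> W \<in> Q \<Longrightarrow> dist_W0 k P Q = d1 k U W"
  unfolding dist_W0_def W0_eq by (rule d1.class_dist)

text \<open>As \<open>delta1\<close> is bounded by \<open>d1\<close>, sets differing by a null set
  are at \<open>delta1\<close> distance zero, so the distance of classes does not depend on
  representatives.\<close>

lemma delta1_W0_eq:
  assumes "P \<in> W0 k" "Q \<in> W0 k" "U \<in> P" "W \<in> Q"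
  shows "delta1_W0 k P Q = delta1 k U W"
  unfolding delta1_W0_def W0_eq
proof (rule class_dist_eq[OF d1.equiv_zero_rel])
  interpret delta1: pseudometric "{W. hypergraphon k W}" "delta1 k" by (rule pseudometric_delta1)
  have "d1.zero_rel k \<subseteq> delta1.zero_rel"
  proof
    fix p assume p: "p \<in> d1.zero_rel k"
    then obtain U W where UW: "p = (U, W)" "hypergraphon k U" "hypergraphon k W" "d1 k U W = 0"
      by (auto simp: d1.zero_rel_def)
    then have "delta1 k U W = 0"
      using delta1_le_d1[of U k W] delta1_nonneg[of k U W] hypergraphon_sets by simp
    then show "p \<in> delta1.zero_rel" using UW by (simp add: delta1.zero_rel_def)
  qed
  then show "delta1 k x y = delta1 k x' y'" if "(x, x') \<in> d1.zero_rel k" "(y, y') \<in> d1.zero_rel k" for x x' y y'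
    using that delta1.dist_respects by blast
qed (use assms in \<open>simp_all add: W0_eq\<close>)

lemma Metric_space_W0: "Metric_space (W0 k) (dist_W0 k)"
  unfolding dist_W0_def W0_eq by (rule d1.Metric_space_quotient)

lemma pseudometric_delta1_W0: "pseudometric (W0 k) (delta1_W0 k)"
proof -
  interpret delta1: pseudometric "{W. hypergraphon k W}" "delta1 k" by (rule pseudometric_delta1)
  show ?thesis
  proof
    fix P Q R assume P: "P \<in> W0 k" and Q: "Q \<in> W0 k" and R: "R \<in> W0 k"
    obtain U V W where "U \<in> P" "V \<in> Q" "W \<in> R" "hypergraphon k U" "hypergraphon k V" "hypergraphon k W"
      using W0_elem P Q R by metis
    then show "0 \<le> delta1_W0 k P Q" "delta1_W0 k P P = 0" "delta1_W0 k P Q = delta1_W0 k Q P"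
      "delta1_W0 k P R \<le> delta1_W0 k P Q + delta1_W0 k Q R"
      using P Q R delta1.nonneg delta1.refl delta1.sym delta1.triangle by (auto simp: delta1_W0_eq)
  qed
qed

theorem theorem2p3:
  fixes k :: nat
  assumes "k > 0"
  shows "\<exists>S. S \<in> measurable (metric_borel (Wt0 k) (dist_Wt0 k)) (metric_borel (W0 k) (dist_W0 k)) \<and>
             (\<forall>C\<in>Wt0 k. S C \<in> C)"
proof -
  let ?cl = "\<lambda>W. d1.zero_rel k `` {W}"
  obtain D where D: "countable D" "\<And>W. W \<in> D \<Longrightarrow> hypergraphon k W"
    "\<And>W e. hypergraphon k W \<Longrightarrow> 0 < e \<Longrightarrow> \<exists>V\<in>D. d1 k V W < e"
    using hypergraphon_separable[of k] by metis
  have "\<exists>S \<in> measurable (metric_borel (Wt0 k) (class_dist (Wt0 k) (delta1_W0 k))) (metric_borel (W0 k) (dist_W0 k)).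
      \<forall>C\<in>Wt0 k. S C \<in> C"
    unfolding Wt0_def
  proof (rule borel_selector_quotient[OF Metric_space_W0 pseudometric_delta1_W0])
    fix P Q assume P: "P \<in> W0 k" and Q: "Q \<in> W0 k"
    obtain U where U: "U \<in> P" "hypergraphon k U" using P by (rule W0_elem)
    obtain W where W: "W \<in> Q" "hypergraphon k W" using Q by (rule W0_elem)
    note Us = hypergraphon_sets[OF U(2)] and Ws = hypergraphon_sets[OF W(2)]
    show "delta1_W0 k P Q \<le> dist_W0 k P Q"
      using delta1_le_d1[OF Us Ws] P Q U W by (simp add: delta1_W0_eq dist_W0_eq)
    fix e assume "delta1_W0 k P Q < e"
    \<comment> \<open>Openness on the level of classes: the pullback of \<open>W\<close> is close to
      \<open>U\<close>, and by \<open>delta1_pullback\<close> its class lies over the same point of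
      the quotient as \<open>Q\<close>.\<close>
    then have "delta1 k U W < e" using P Q U W by (simp add: delta1_W0_eq)
    then obtain \<psi> where \<psi>: "structure_preserving k \<psi>" "d1 k U (pullback k \<psi> W) < e"
      using delta1_lessE[OF Us Ws] by blast
    note h = hypergraphon_pullback[OF W(2) \<psi>(1)]
    have "delta1_W0 k Q (?cl (pullback k \<psi> W)) = 0"
      using delta1_W0_eq[OF Q W0_class(1)[OF h] W(1) W0_class(2)[OF h]] delta1_pullback[OF Ws \<psi>(1)] by simp
    moreover have "dist_W0 k P (?cl (pullback k \<psi> W)) < e"
      using dist_W0_eq[OF P W0_class(1)[OF h] U(1) W0_class(2)[OF h]] \<psi>(2) by simp
    ultimately show "\<exists>R\<in>W0 k. delta1_W0 k Q R = 0 \<and> dist_W0 k P R < e"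
      using W0_class(1)[OF h] by blast
  next
    show "countable (?cl ` D)" using D(1) by (rule countable_image)
    show "?cl ` D \<subseteq> W0 k" using D(2) W0_class(1) by blast
    fix P and e :: real assume P: "P \<in> W0 k" and e: "0 < e"
    obtain W where W: "W \<in> P" "hypergraphon k W" using P by (rule W0_elem)
    obtain V where V: "V \<in> D" "d1 k V W < e" using D(3)[OF W(2) e] by blast
    have "dist_W0 k (?cl V) P < e"
      using dist_W0_eq[OF W0_class(1) P W0_class(2) W(1)] D(2)[OF V(1)] V(2) by simp
    then show "\<exists>R\<in>?cl ` D. dist_W0 k R P < e" using V(1) by blast
  next
    fix \<sigma> assume "range \<sigma> \<subseteq> W0 k" and d: "\<And>n. dist_W0 k (\<sigma> n) (\<sigma> (Suc n)) < (1/2) ^ n"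
    then have \<sigma>: "\<sigma> n \<in> W0 k" for n by auto
    then have "\<exists>W. W \<in> \<sigma> n" for n by (meson W0_elem)
    \<comment> \<open>Completeness passes from sets to classes by choosing a representative of each
      term; distances of classes are those of representatives.\<close>
    then obtain W where W: "\<And>n. W n \<in> \<sigma> n" by metis
    have "hypergraphon k (W n)" for n using W0_hypergraphon[OF \<sigma> W] .
    moreover have "d1 k (W n) (W (Suc n)) < (1/2) ^ n" for n using d[of n] dist_W0_eq[OF \<sigma> \<sigma> W W] by simp
    ultimately obtain L where L: "hypergraphon k L" "\<And>n. d1 k (W n) L \<le> 2 * (1/2) ^ n"
      using hypergraphon_limit[of k W] by blast
    have "dist_W0 k (\<sigma> n) (?cl L) \<le> 2 * (1/2) ^ n" for n
      using dist_W0_eq[OF \<sigma> W0_class(1)[OF L(1)] W W0_class(2)[OF L(1)]] L(2) by simp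
    then show "\<exists>l\<in>W0 k. \<forall>n. dist_W0 k (\<sigma> n) l \<le> 2 * (1/2) ^ n" using W0_class(1)[OF L(1)] by blast
  next
    have "hypergraphon k {}" by (rule hypergraphonI) auto
    then show "W0 k \<noteq> {}" using W0_class(1) by blast
  qed
  then show ?thesis unfolding dist_Wt0_def by blast
qed

end
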